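(* Consider the planar map $F(x,y)=\left(y,\dfrac{f(y)}{x}\right)$, where $f$ is a real rational function with $\deg(f)>2$. If $p$ is an elliptic fixed point of $F$, not $(2n+1)$-resonant, and such that its first non-vanishing Birkhoff constant is $B_n=i\,b_n$ for some $0<n\in\mathbb{N}$ and $b_n\in\mathbb{R}\setminus\{0\}$, then $F$ is not $\mathcal{C}^{2n+4}$-locally integrable at $p$.
   Context: For a rational function $f=P/Q$, with $P,Q$ polynomials, $\deg(f)=\deg(P)-\deg(Q)$. The map is considered where it is defined. Elliptic fixed point: a fixed point $p$ of $F$ such that the eigenvalues $\lambda,\bar\lambda=1/\lambda$ of $DF(p)$ lie on the unit circle of $\mathbb{C}$ and are different from $\pm1$. It is not $k$-resonant if $\lambda^\ell\neq 1$ for all $0<\ell\le k$. Birkhoff constants: near a not $k$-resonant elliptic fixed point, a $\mathcal{C}^{k}$ map $F$ is locally conjugate (moving $p$ to $0$, with $z=x+iy$) to its Birkhoff normal form $F_B(z)=\lambda z\bigl(1+\sum_{j=1}^{[(k-1)/2]}B_j (z\bar z)^j\bigr)+o(|z|^k)$, where $[\cdot]$ is the integer part; the $B_j\in\mathbb{C}$ are the Birkhoff constants. "The first non-vanishing Birkhoff constant is $B_n$" means $B_1=\dots=B_{n-1}=0$ and $B_n\ne0$ (here with $k=2n+1$). $\mathcal{C}^m$-locally integrable at an elliptic fixed point $p$ ($m\ge2$): there exist a neighborhood $\mathcal{U}$ of $p$ and a locally non-constant real valued function $V\in\mathcal{C}^m(\mathcal{U})$ (a first integral) such that $V(F(x))=V(x)$,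 all the level curves $\{V=h\}\cap\mathcal{U}$ are closed curves surrounding $p$ and, moreover, $p$ is an isolated non-degenerate critical point of $V$ in $\mathcal{U}$. *)

theory Defs
  imports
    "HOL-Analysis.Analysis"
    "HOL-Library.Landau_Symbols"
    "HOL-Computational_Algebra.Polynomial"
begin

definition rat_degree :: "real poly \<Rightarrow> real poly \<Rightarrow> int" where
  "rat_degree P Q = int (degree P) - int (degree Q)"

text \<open>
  The map \<open>F (x, y) = (y, f y / x)\<close> with \<open>f = P / Q\<close>. Since division by zero is total in HOL,
  the values of \<open>recurrence_map\<close> are meaningful only on \<open>recurrence_dom\<close>, which is open.
  \<open>P\<close> and \<open>Q\<close> are not required to be coprime.
\<close>

definition recurrence_map :: "real poly \<Rightarrow> real poly \<Rightarrow> real^2 \<Rightarrow> real^2" where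
  "recurrence_map P Q v = vector [v $ 2, (poly P (v $ 2) / poly Q (v $ 2)) / (v $ 1)]"

definition recurrence_dom :: "real poly \<Rightarrow> real poly \<Rightarrow> (real^2) set" where
  "recurrence_dom P Q = {v. v $ 1 \<noteq> 0 \<and> poly Q (v $ 2) \<noteq> 0}"

text \<open>
  \<open>C^k\<close> functions, intended for open sets \<open>S\<close> in Euclidean spaces: all directional derivatives,
  in constant directions, of order up to \<open>k\<close> exist and are continuous.
\<close>

primrec Ck_on :: "nat \<Rightarrow> 'a::euclidean_space set \<Rightarrow> ('a \<Rightarrow> 'b::euclidean_space) \<Rightarrow> bool" where
  "Ck_on 0 S f \<longleftrightarrow> continuous_on S f"
| "Ck_on (Suc k) S f \<longleftrightarrow> (\<forall>x\<in>S. f differentiable (at x)) \<and>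
     (\<forall>v. Ck_on k S (\<lambda>x. frechet_derivative f (at x) v))"

definition Ck_diffeo ::
  "nat \<Rightarrow> 'a::euclidean_space set \<Rightarrow> 'b::euclidean_space set \<Rightarrow> ('a \<Rightarrow> 'b) \<Rightarrow> ('b \<Rightarrow> 'a) \<Rightarrow> bool" where
  "Ck_diffeo k S T \<Phi> \<Psi> \<longleftrightarrow>
     open S \<and> open T \<and> homeomorphism S T \<Phi> \<Psi> \<and> Ck_on k S \<Phi> \<and> Ck_on k T \<Psi>"

definition complex_eigenvalue :: "real^'n^'n \<Rightarrow> complex \<Rightarrow> bool" where
  "complex_eigenvalue A \<nu> \<longleftrightarrow>
     (\<exists>v::complex^'n. v \<noteq> 0 \<and> (\<chi> i j. complex_of_real (A $ i $ j)) *v v = \<nu> *s v)"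

text \<open>
  In the following definitions \<open>D\<close> is the (open) set on which \<open>F\<close> is considered.
  The multiplier \<open>\<mu>\<close> is either one of the two conjugate eigenvalues.
\<close>

definition elliptic_fixed_point ::
  "(real^2) set \<Rightarrow> (real^2 \<Rightarrow> real^2) \<Rightarrow> real^2 \<Rightarrow> complex \<Rightarrow> bool" where
  "elliptic_fixed_point D F p \<mu> \<longleftrightarrow>
     p \<in> D \<and> F p = p \<and> F differentiable (at p) \<and>
     {\<nu>. complex_eigenvalue (jacobian F (at p)) \<nu>} = {\<mu>, cnj \<mu>} \<and>
     cmod \<mu> = 1 \<and> \<mu> \<noteq> 1 \<and> \<mu> \<noteq> - 1"

definition resonant :: "nat \<Rightarrow> complex \<Rightarrow> bool" where
  "resonant k \<mu> \<longleftrightarrow> (\<exists>l. 0 < l \<and> l \<le> k \<and> \<mu> ^ l = 1)"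

definition birkhoff_poly :: "complex \<Rightarrow> nat \<Rightarrow> (nat \<Rightarrow> complex) \<Rightarrow> complex \<Rightarrow> complex" where
  "birkhoff_poly \<mu> k B z = \<mu> * z * (1 + (\<Sum>j = 1..(k - 1) div 2. B j * (z * cnj z) ^ j))"

text \<open>
  \<open>B 1, \<dots>, B ((k - 1) div 2)\<close> are Birkhoff constants of \<open>F\<close> at \<open>p\<close>: some \<open>C^k\<close> change of
  variables sending \<open>p\<close> to \<open>0\<close> conjugates \<open>F\<close> to its Birkhoff normal form. This is a relation, since the
  constants depend on the change of variables: only the first non-zero one is determined, up to a
  positive factor and complex conjugation.
\<close>

definition birkhoff_constants ::
  "(real^2 \<Rightarrow> real^2) \<Rightarrow> real^2 \<Rightarrow> complex \<Rightarrow> nat \<Rightarrow> (nat \<Rightarrow> complex) \<Rightarrow> bool" where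
  "birkhoff_constants F p \<mu> k B \<longleftrightarrow>
     (\<exists>S T \<Phi> \<Psi>. Ck_diffeo k S T \<Phi> \<Psi> \<and> p \<in> S \<and> \<Phi> p = 0 \<and>
        (\<lambda>z. \<Phi> (F (\<Psi> z)) - birkhoff_poly \<mu> k B z) \<in> o[at 0](\<lambda>z. complex_of_real (cmod z ^ k)))"

definition critical_point :: "(real^2 \<Rightarrow> real) \<Rightarrow> real^2 \<Rightarrow> bool" where
  "critical_point V x \<longleftrightarrow> (V has_derivative (\<lambda>_. 0)) (at x)"

definition grad :: "(real^2 \<Rightarrow> real) \<Rightarrow> real^2 \<Rightarrow> real^2" where
  "grad V x = (\<chi> i. frechet_derivative V (at x) (axis i 1))"

definition hessian :: "(real^2 \<Rightarrow> real) \<Rightarrow> real^2 \<Rightarrow> real^2^2" where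
  "hessian V x = jacobian (grad V) (at x)"

definition closed_curve_surrounding :: "real^2 \<Rightarrow> (real^2) set \<Rightarrow> bool" where
  "closed_curve_surrounding p C \<longleftrightarrow>
     (\<exists>\<gamma>. simple_path \<gamma> \<and> pathfinish \<gamma> = pathstart \<gamma> \<and> path_image \<gamma> = C \<and> p \<in> inside C)"

text \<open>
  The level set through \<open>p\<close> itself degenerates to \<open>{p}\<close>. This is enforced by the condition on
  level curves, as a curve surrounding \<open>p\<close> does not contain \<open>p\<close>. Invariance is demanded only at
  those points of \<open>U\<close> where \<open>V (F x)\<close> makes sense.
\<close>

definition locally_integrable_at ::
  "nat \<Rightarrow> (real^2) set \<Rightarrow> (real^2 \<Rightarrow> real^2) \<Rightarrow> real^2 \<Rightarrow> bool" where
  "locally_integrable_at m D F p \<longleftrightarrow>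
     (\<exists>U V. open U \<and> p \<in> U \<and> Ck_on m U V \<and>
        (\<forall>W. open W \<and> W \<noteq> {} \<and> W \<subseteq> U \<longrightarrow> \<not> V constant_on W) \<and>
        (\<forall>x \<in> U \<inter> D. F x \<in> U \<longrightarrow> V (F x) = V x) \<and>
        (\<forall>h \<in> V ` (U - {p}). closed_curve_surrounding p {x \<in> U. V x = h}) \<and>
        p isolated_in {x \<in> U. critical_point V x} \<and> det (hessian V p) \<noteq> 0)"

end

theory Submission
  imports Defs "HOL-Library.Multiset" "HOL-Library.Function_Algebras"
begin

text \<open>
  The map has only finitely many \<open>N\<close>-periodic points for every \<open>N\<close>: along a periodic orbit
  \<open>x\<^sub>i\<^sub>-\<^sub>1 x\<^sub>i\<^sub>+\<^sub>1 Q(x\<^sub>i) = P(x\<^sub>i)\<close>, and since \<open>deg P > deg Q + 2\<close> the top homogeneous part of the \<open>i\<close>-th equation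
  is a multiple of \<open>x\<^sub>i\<close> to the power \<open>deg P\<close>, so the polynomial functions on the solution set form a
  finite-dimensional space.

  On the other hand, a first integral with a non-degenerate critical point at an elliptic fixed point
  has a strict extremum there, so its level curves confine the orbits and, in normal form
  coordinates, it is strictly monotone on short rays. The non-zero Birkhoff constant \<open>\<i> b\<^sub>n\<close> makes the
  map a twist. Hence for large \<open>N\<close> each of the infinitely many rays contains an \<open>N\<close>-periodic point.
\<close>

text \<open>The two halves meet in the count of \<open>N\<close>-periodic points for one well chosen
  \<open>N\<close>. Finiteness is linear algebra rather than elimination theory: a coordinate taking
  infinitely many values on the solution set would have linearly independent powers, which a
  finite-dimensional space of functions cannot contain. Infinitude would usually call for a fixed
  point theorem for area-preserving annulus maps. Here the first integral removes the radial
  unknown: a point mapped into its own ray must return to itself. There remains one real equation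
  for the angle on each ray, solved by the intermediate value theorem. The bounds on the angular
  displacement depend on the radius only, so the same \<open>N\<close> serves all rays, and
  different rays give different points. Invariance of the integral and the conjugacy by the chart
  are available only near the fixed point, so the sets of periodic points carry the condition that
  the entire orbit stays in a small ball or in the domain.\<close>

section \<open>Finiteness of the set of periodic points\<close>

interpretation real_fun: vector_space "\<lambda>(c::real) (f::'a \<Rightarrow> real) x. c * f x"
  by unfold_locales (auto simp: algebra_simps plus_fun_def)

lemma sum_fun_apply: "(\<Sum>i\<in>A. f i) x = (\<Sum>i\<in>A. (f i x :: real))"
  by (induction A rule: infinite_finite_induct) (auto simp: plus_fun_def zero_fun_def)

text \<open>A linear relation between powers of \<open>g\<close> on \<open>Z\<close> is a polynomial
  with infinitely many roots \<open>g a\<close>, so the powers are independent, and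
  \<open>card T + 1\<close> of them cannot lie in the span of \<open>T\<close>. Functions are cut
  off to 0 outside \<open>Z\<close> so that agreement on \<open>Z\<close> becomes equality of total
  functions.\<close>

lemma powers_infinite_range_not_finite_span:
  fixes g :: "'a \<Rightarrow> real"
  assumes inf: "infinite (g ` Z)" and T: "finite T"
    and sp: "\<And>k. (\<lambda>a. if a \<in> Z then g a ^ k else 0) \<in> real_fun.span T"
  shows False
proof -
  define pw where "pw k = (\<lambda>a. if a \<in> Z then g a ^ k else 0)" for k :: nat
  have zero: "p = 0" if "\<And>a. a \<in> Z \<Longrightarrow> poly p (g a) = 0" for p :: "real poly"
  proof (rule ccontr)
    assume "p \<noteq> 0"
    then have "finite {x. poly p x = 0}"
      by (rule poly_roots_finite)
    moreover have "g ` Z \<subseteq> {x. poly p x = 0}"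
      using that by auto
    ultimately show False
      using inf finite_subset by blast
  qed
  \<comment> \<open>Distinctness of the powers lets \<open>card S\<close> count exponents and turns
    sums over the set \<open>S\<close> into sums over exponents.\<close>
  have inj: "inj_on pw A" for A
  proof (rule inj_onI)
    fix k l assume eq: "pw k = pw l"
    have "monom 1 k - monom 1 l = (0 :: real poly)"
    proof (rule zero)
      fix a assume "a \<in> Z"
      with fun_cong[OF eq, of a] show "poly (monom 1 k - monom 1 l) (g a) = 0"
        by (simp add: pw_def poly_monom)
    qed
    then show "k = l"
      by (metis eq_iff_diff_eq_0 monom_eq_iff' zero_neq_one)
  qed
  define S where "S = pw ` {..card T}"
  have "real_fun.independent S"
  proof (rule real_fun.independent_if_scalars_zero)
    show "finite S"
      by (simp add: S_def)
    fix f x assume 0: "(\<Sum>v\<in>S. (\<lambda>y. f v * v y)) = 0" and "x \<in> S"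
    then obtain k where k: "k \<le> card T" "x = pw k"
      by (auto simp: S_def)
    have "(\<Sum>k\<le>card T. monom (f (pw k)) k) = 0"
    proof (rule zero)
      fix a assume a: "a \<in> Z"
      have "0 = (\<Sum>v\<in>S. f v * v a)"
        using fun_cong[OF 0, of a] by (simp add: sum_fun_apply zero_fun_def)
      also have "\<dots> = (\<Sum>k\<le>card T. f (pw k) * pw k a)"
        unfolding S_def by (subst sum.reindex[OF inj]) simp
      finally show "poly (\<Sum>k\<le>card T. monom (f (pw k)) k) (g a) = 0"
        using a by (simp add: poly_sum poly_monom pw_def)
    qed
    then have "coeff (\<Sum>k\<le>card T. monom (f (pw k)) k) k = 0"
      by simp
    then show "f x = 0"
      using k by (simp add: coeff_sum coeff_monom if_distrib sum.delta cong: if_cong)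
  qed
  moreover have "S \<subseteq> real_fun.span T"
    using sp by (auto simp: S_def pw_def)
  ultimately have "card S \<le> card T"
    using real_fun.independent_span_bound[OF T] by blast
  moreover have "card S = Suc (card T)"
    unfolding S_def by (simp add: card_image[OF inj])
  ultimately show False
    by simp
qed

text \<open>Pigeonhole for exponents: a multiset of indices stands for a monomial, its size for the
  total degree, and \<open>count M i\<close> for the exponent of the variable
  \<open>i\<close>.\<close>

lemma mset_large_count:
  assumes "finite I" "set_mset M \<subseteq> I" "size M > card I * d"
  obtains i where "i \<in> I" "count M i \<ge> d"
proof -
  have "size M = (\<Sum>i\<in>I. count M i)"
    unfolding size_multiset_overloaded_eq
    by (rule sum.mono_neutral_left) (use assms in \<open>auto simp: not_in_iff\<close>)
  have "\<exists>i\<in>I. count M i \<ge> d"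
  proof (rule ccontr)
    assume "\<not> ?thesis"
    then have "(\<Sum>i\<in>I. count M i) \<le> (\<Sum>i\<in>I. d)"
      by (intro sum_mono) auto
    with \<open>size M = _\<close> assms show False
      by simp
  qed
  with that show ?thesis by blast
qed

text \<open>
  The relation at \<open>i\<close> rewrites \<open>(a i) ^ degree P\<close> as a combination of monomials of smaller total
  degree, so on \<open>Z\<close> every monomial is a combination of those of bounded degree.
\<close>

lemma finite_coordinate_values:
  fixes P Q :: "real poly" and pr su :: "'i \<Rightarrow> 'i" and Z :: "('i \<Rightarrow> real) set"
  assumes I: "finite I" "\<And>i. i \<in> I \<Longrightarrow> pr i \<in> I" "\<And>i. i \<in> I \<Longrightarrow> su i \<in> I"
    and deg: "degree P > degree Q + 2"
    and Z: "\<And>a i. a \<in> Z \<Longrightarrow> i \<in> I \<Longrightarrow> a (pr i) * a (su i) * poly Q (a i) = poly P (a i)"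
    and j: "j \<in> I"
  shows "finite ((\<lambda>a. a j) ` Z)"
proof (rule ccontr)
  assume inf: "infinite ((\<lambda>a. a j) ` Z)"
  define d where "d = degree P"
  define mon where "mon M = (\<lambda>a. if a \<in> Z then \<Prod>i\<in>#M. a i else 0)" for M :: "'i multiset"
  \<comment> \<open>Above total degree \<open>card I * d\<close> some variable is forced to occur
    with exponent at least \<open>d\<close>, so rewriting can continue; below it only finitely many
    monomials remain.\<close>
  define T where "T = mon ` (\<Union>s\<le>card I * d. multisets_of_size I s)"
  have fT: "finite T"
    unfolding T_def using I(1) by auto
  have lc: "coeff P d \<noteq> 0"
    using deg by (auto simp: d_def)
  have span: "mon M \<in> real_fun.span T" if "set_mset M \<subseteq> I" for M
    using that
  proof (induction "size M" arbitrary: M rule: less_induct)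
    case less
    show ?case
    proof (cases "size M \<le> card I * d")
      case True
      then have "mon M \<in> T"
        using less.prems by (auto simp: T_def multisets_of_size_def)
      then show ?thesis
        by (rule real_fun.span_base)
    next
      case False
      then obtain i where i: "i \<in> I" "count M i \<ge> d"
        using mset_large_count[OF I(1) less.prems, of d] by auto
      define N where "N = M - replicate_mset d i"
      have M: "M = N + replicate_mset d i"
        unfolding N_def using i(2) by (simp add: count_le_replicate_mset_subset_eq)
      have N: "set_mset N \<subseteq> I"
        using less.prems M by auto
      have szM: "size M = size N + d"
        using M by simp
      \<comment> \<open>The monomials produced by rewriting \<open>a i ^ d\<close> in
        \<open>M\<close>. The sizes are \<open>size N + 2 + k\<close> with
        \<open>k \<le> degree Q\<close> for \<open>A k\<close>, and \<open>size N + k\<close> with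
        \<open>k < d\<close> for \<open>C k\<close>; both are below \<open>size N + d\<close>
        because of \<open>deg\<close>. Multisets tolerate \<open>pr i\<close> and
        \<open>su i\<close> coinciding with each other or with \<open>i\<close>, as happens for
        periods 1 and 2.\<close>
      define A where "A k = {#pr i, su i#} + N + replicate_mset k i" for k
      define C where "C k = N + replicate_mset k i" for k
      have *: "mon (A k) \<in> real_fun.span T" if "k \<le> degree Q" for k
        by (rule less.hyps) (use that deg szM N I i in \<open>auto simp: A_def d_def\<close>)
      have **: "mon (C k) \<in> real_fun.span T" if "k < d" for k
        by (rule less.hyps) (use that deg szM N I i in \<open>auto simp: C_def d_def\<close>)
      have eq: "mon M = (\<lambda>a. (1 / coeff P d) * ((\<Sum>k\<le>degree Q. (\<lambda>a. coeff Q k * mon (A k) a)) -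
          (\<Sum>k<d. (\<lambda>a. coeff P k * mon (C k) a))) a)" (is "_ = ?r")
      proof
        fix a
        show "mon M a = ?r a"
        proof (cases "a \<in> Z")
          case True
          let ?n = "\<Prod>i\<in>#N. a i"
          have "poly P (a i) = (\<Sum>k<d. coeff P k * a i ^ k) + coeff P d * a i ^ d"
            by (simp add: poly_altdef d_def flip: lessThan_Suc_atMost)
          then have "coeff P d * a i ^ d = a (pr i) * a (su i) * (\<Sum>k\<le>degree Q. coeff Q k * a i ^ k)
              - (\<Sum>k<d. coeff P k * a i ^ k)"
            using Z[OF True i(1)] by (simp add: poly_altdef)
          then have "coeff P d * (?n * a i ^ d) =
             ?n * (a (pr i) * a (su i) * (\<Sum>k\<le>degree Q. coeff Q k * a i ^ k) - (\<Sum>k<d. coeff P k * a i ^ k))"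
            by (metis mult.left_commute)
          also have "\<dots> = (\<Sum>k\<le>degree Q. coeff Q k * mon (A k) a) - (\<Sum>k<d. coeff P k * mon (C k) a)"
            using True
            by (simp add: right_diff_distrib sum_distrib_left A_def C_def mon_def algebra_simps)
          finally show ?thesis
            using True lc by (simp add: sum_fun_apply fun_diff_def mon_def M field_simps)
        qed (simp add: mon_def sum_fun_apply fun_diff_def)
      qed
      show ?thesis
        unfolding eq
        by (intro real_fun.span_scale real_fun.span_diff real_fun.span_sum * **) auto
    qed
  qed
  have "(\<lambda>a. if a \<in> Z then a j ^ k else 0) \<in> real_fun.span T" for k
    using span[of "replicate_mset k j"] j by (simp add: mon_def cong: if_cong)
  from powers_infinite_range_not_finite_span[OF inf fT this] show False .
qed

text \<open>The second coordinate of a point is the first coordinate of its image, so the map is a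
  second-order recurrence and an \<open>N\<close>-periodic orbit is a solution of a cyclic system in
  \<open>N\<close> real unknowns. Requiring the whole orbit to lie in the domain makes it legitimate
  to clear denominators.\<close>

lemma finite_periodic_points:
  fixes P Q :: "real poly"
  assumes deg: "degree P > degree Q + 2" and N: "0 < N"
  defines "F \<equiv> recurrence_map P Q"
  shows "finite {v. (F ^^ N) v = v \<and> (\<forall>k. (F ^^ k) v \<in> recurrence_dom P Q)}" (is "finite ?S")
proof -
  define a where "a v k = (F ^^ k) v $ 1" for v k
  have fin: "finite ((\<lambda>a. a j) ` (a ` ?S))" if "j < N" for j
  \<comment> \<open>Adding \<open>N\<close> before subtracting 1 protects the predecessor of index 0
    from truncated subtraction.\<close>
  proof (rule finite_coordinate_values[where I = "{..<N}" and pr = "\<lambda>i. (i + N - 1) mod N"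
        and su = "\<lambda>i. (i + N + 1) mod N" and P = P and Q = Q])
    fix b i assume "b \<in> a ` ?S" and i: "i \<in> {..<N}"
    then obtain v where v: "(F ^^ N) v = v" "\<And>k. (F ^^ k) v \<in> recurrence_dom P Q" and b: "b = a v"
      by auto
    have per: "a v (k mod N) = a v k" for k
      using v(1) by (simp add: a_def funpow_mod_eq)
    \<comment> \<open>The equation at index \<open>i\<close> is read off at the orbit point one step
      earlier; the shift by a full period provides such a point for \<open>i = 0\<close>.\<close>
    define k where "k = i + N - 1"
    have k: "k + 1 = i + N"
      using N by (simp add: k_def)
    define w where "w = (F ^^ k) v"
    have w: "w \<in> recurrence_dom P Q"
      unfolding w_def by (rule v(2))
    have 1: "w $ 1 = a v k" "w $ 2 = a v (k + 1)" "F w $ 2 = a v (k + 2)"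
      by (simp_all add: a_def w_def F_def recurrence_map_def)
    have 2: "a v (k + 1) = a v i"
      using per[of "i + N"] per[of i] i k by simp
    have "F w $ 2 = poly P (w $ 2) / poly Q (w $ 2) / w $ 1"
      by (simp add: F_def recurrence_map_def)
    then have "w $ 1 * F w $ 2 * poly Q (w $ 2) = poly P (w $ 2)"
      using w by (simp add: recurrence_dom_def field_simps)
    then have "a v k * a v (k + 2) * poly Q (a v i) = poly P (a v i)"
      unfolding 1 2 .
    moreover have "k + 2 = i + N + 1" "k = i + N - 1"
      using k by auto
    ultimately show "b ((i + N - 1) mod N) * b ((i + N + 1) mod N) * poly Q (b i) = poly P (b i)"
      unfolding b per by simp
  qed (use N deg that in auto)
  \<comment> \<open>The first two terms of the recurrence determine the point. The index
    \<open>1 mod N\<close> covers \<open>N = 1\<close>, where 0 is the only index in range.\<close>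
  have "?S \<subseteq> (\<lambda>(x, y). vector [x, y]) ` (((\<lambda>a. a 0) ` (a ` ?S)) \<times> ((\<lambda>a. a (1 mod N)) ` (a ` ?S)))"
  proof
    fix v assume v: "v \<in> ?S"
    have "a v (1 mod N) = a v 1"
      using v funpow_mod_eq[where f = F and n = N and m = 1 and x = v] by (simp add: a_def)
    then have "v = vector [a v 0, a v (1 mod N)]"
      by (simp add: a_def F_def recurrence_map_def vec_eq_iff forall_2)
    then show "v \<in> (\<lambda>(x, y). vector [x, y]) `
        (((\<lambda>a. a 0) ` (a ` ?S)) \<times> ((\<lambda>a. a (1 mod N)) ` (a ` ?S)))"
      using v by (intro image_eqI[of _ _ "(a v 0, a v (1 mod N))"]) auto
  qed
  moreover have "finite \<dots>"
    by (rule finite_imageI, rule finite_cartesian_product; rule fin) (use N in simp_all)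
  ultimately show ?thesis
    by (rule finite_subset)
qed

section \<open>Periodic points of twist maps with an invariant function\<close>

text \<open>\<open>W\<close> is comparable to the squared norm, so on one of its level sets the norm
  varies at most by the factor \<open>C\<close>, the square root of \<open>M / m\<close>. Since
  \<open>W\<close> is known to be invariant only within radius \<open>r\<close>, this bound and the
  invariance must be carried along together in the induction; \<open>C * norm z < r\<close> closes
  the loop.\<close>

lemma funpow_stays:
  fixes H :: "'a::real_normed_vector \<Rightarrow> 'a" and W :: "'a \<Rightarrow> real"
  assumes m: "0 < m" and C: "M = C\<^sup>2 * m" "1 \<le> C"
    and W: "\<And>z. norm z < R \<Longrightarrow> m * (norm z)\<^sup>2 \<le> W z \<and> W z \<le> M * (norm z)\<^sup>2"
    and H: "\<And>z. norm z < r \<Longrightarrow> norm (H z) < R \<and> W (H z) = W z" and "r \<le> R"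
    and z: "C * norm z < r"
  shows "W ((H ^^ k) z) = W z \<and> norm ((H ^^ k) z) \<le> C * norm z \<and> norm z \<le> C * norm ((H ^^ k) z)"
proof -
  have zr: "norm z < R"
    using z C(2) \<open>r \<le> R\<close> mult_right_mono[of 1 C "norm z"] by simp
  have near: "norm w \<le> C * norm z" "norm z \<le> C * norm w" if "W w = W z" "norm w < R" for w
  proof -
    have "m * (norm w)\<^sup>2 \<le> m * (C * norm z)\<^sup>2"
      using W[OF that(2)] W[OF zr] that(1) C(1) by (simp add: power_mult_distrib mult_ac)
    then have "(norm w)\<^sup>2 \<le> (C * norm z)\<^sup>2"
      using m by simp
    then show "norm w \<le> C * norm z"
      by (rule power2_le_imp_le) (use C(2) in simp)
    have "m * (norm z)\<^sup>2 \<le> m * (C * norm w)\<^sup>2"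
      using W[OF that(2)] W[OF zr] that(1) C(1) by (simp add: power_mult_distrib mult_ac)
    then have "(norm z)\<^sup>2 \<le> (C * norm w)\<^sup>2"
      using m by simp
    then show "norm z \<le> C * norm w"
      by (rule power2_le_imp_le) (use C(2) in simp)
  qed
  show ?thesis
  proof (induction k)
    case 0
    then show ?case
      using near[of z] zr by simp
  next
    case (Suc k)
    then have "norm ((H ^^ k) z) < r"
      using z by linarith
    then have "W ((H ^^ Suc k) z) = W z" "norm ((H ^^ Suc k) z) < R"
      using H[of "(H ^^ k) z"] Suc by simp_all
    then show ?case
      using near by blast
  qed
qed

text \<open>
  The angle gained in \<open>N\<close> steps tends to \<open>0\<close> along each ray but exceeds \<open>2 * pi\<close> on a fixed circle
  once \<open>N\<close> is large. So every ray contains a point which \<open>H ^^ N\<close> maps into the same ray, and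
  which is then fixed because the invariant \<open>W\<close> is injective on rays.
\<close>

lemma infinite_periodic_points_of_twist:
  fixes H :: "complex \<Rightarrow> complex" and W \<phi> :: "complex \<Rightarrow> real"
  assumes m: "0 < m" "m \<le> M" and r: "0 < r" "r \<le> R"
    and W: "\<And>z. norm z < R \<Longrightarrow> m * (norm z)\<^sup>2 \<le> W z \<and> W z \<le> M * (norm z)\<^sup>2"
    and H: "\<And>z. norm z < r \<Longrightarrow> norm (H z) < R \<and> W (H z) = W z"
    and ray: "\<And>u s t. norm u = 1 \<Longrightarrow> 0 < s \<Longrightarrow> s < t \<Longrightarrow> t < R \<Longrightarrow>
        W (complex_of_real s * u) < W (complex_of_real t * u)"
    and contH: "continuous_on (ball 0 r) H"
    and cont\<phi>: "continuous_on (ball 0 r - {0}) \<phi>"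
    and l: "0 < l" and c: "0 < c1"
    and \<phi>: "\<And>z. 0 < norm z \<Longrightarrow> norm z < r \<Longrightarrow> c1 * norm z ^ l \<le> \<phi> z \<and> \<phi> z \<le> c2 * norm z ^ l"
    and \<epsilon>: "\<epsilon> = 1 \<or> \<epsilon> = - 1" and \<mu>: "norm \<mu> = 1"
    and Harg: "\<And>z. 0 < norm z \<Longrightarrow> norm z < r \<Longrightarrow>
        sgn (H z) = \<mu> * sgn z * cis (\<epsilon> * \<phi> z)"
  obtains N where "0 < N"
    "infinite {z. (H ^^ N) z = z \<and> (\<forall>k. (H ^^ k) z \<noteq> 0 \<and> norm ((H ^^ k) z) < r)}"
proof -
  define C where "C = sqrt (M / m)"
  have C: "M = C\<^sup>2 * m" "1 \<le> C"
    using m by (simp_all add: C_def)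
  define \<delta> where "\<delta> = r / (2 * C)"
  have \<delta>: "0 < \<delta>" "\<And>z :: complex. norm z \<le> \<delta> \<Longrightarrow> C * norm z < r"
  proof -
    show "0 < \<delta>"
      using r C by (simp add: \<delta>_def)
    fix z :: complex assume "norm z \<le> \<delta>"
    then have "C * norm z \<le> C * \<delta>"
      using C by (intro mult_left_mono) auto
    also have "C * \<delta> < r"
      using r C by (simp add: \<delta>_def)
    finally show "C * norm z < r" .
  qed
  have orbit: "W ((H ^^ k) z) = W z \<and> norm ((H ^^ k) z) \<le> C * norm z \<and> norm z \<le> C * norm ((H ^^ k) z)"
    if "norm z \<le> \<delta>" for z k
    by (rule funpow_stays[where m = m and M = M and R = R and r = r, OF m(1) C])
       (use W H r(2) \<delta>(2)[OF that] in auto)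
  have orbit_r: "norm ((H ^^ k) z) < r" if "norm z \<le> \<delta>" for k z
    using orbit[OF that, of k] \<delta>(2)[OF that] by linarith
  have orbit_0: "0 < norm ((H ^^ k) z)" if "norm z \<le> \<delta>" "z \<noteq> 0" for k z
    using orbit[OF that(1), of k] that(2) C(2) by auto
  \<comment> \<open>A real-valued lift of the angle gained in \<open>N\<close> steps, apart from the
    rotation by \<open>\<mu> ^ N\<close> and the sense \<open>\<epsilon>\<close>. Summing the
    one-step lifts keeps it continuous, where an argument function would jump.\<close>
  define \<alpha> where "\<alpha> N z = (\<Sum>k<N. \<phi> ((H ^^ k) z))" for N z
  have arg: "sgn ((H ^^ N) z) = \<mu> ^ N * sgn z * cis (\<epsilon> * \<alpha> N z)" if "norm z \<le> \<delta>" "z \<noteq> 0" for N z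
  proof (induction N)
    case (Suc N)
    have "sgn ((H ^^ Suc N) z) = \<mu> * sgn ((H ^^ N) z) * cis (\<epsilon> * \<phi> ((H ^^ N) z))"
      using Harg[of "(H ^^ N) z"] orbit_0[OF that, of N] orbit_r[OF that(1), of N] by simp
    then show ?case
      by (simp add: Suc \<alpha>_def cis_mult distrib_left mult_ac add_ac)
  qed (simp add: \<alpha>_def)
  have upper: "\<alpha> N z \<le> real N * (c2 * (C * norm z) ^ l)" and lower: "real N * (c1 * (norm z / C) ^ l) \<le> \<alpha> N z"
    if z: "norm z \<le> \<delta>" "z \<noteq> 0" for N z
  proof -
    have ang: "c1 * norm ((H ^^ k) z) ^ l \<le> \<phi> ((H ^^ k) z) \<and> \<phi> ((H ^^ k) z) \<le> c2 * norm ((H ^^ k) z) ^ l" for k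
      using \<phi>[of "(H ^^ k) z"] orbit_0[OF z, of k] orbit_r[OF z(1), of k] by simp
    have c2: "0 \<le> c2"
    proof -
      have "0 < norm z ^ l"
        using z by simp
      moreover have "c1 * norm z ^ l \<le> c2 * norm z ^ l"
        using ang[of 0] by simp
      ultimately show ?thesis
        using c by simp
    qed
    have "\<alpha> N z \<le> (\<Sum>k<N. c2 * (C * norm z) ^ l)"
      unfolding \<alpha>_def
    proof (rule sum_mono)
      fix k
      have "c2 * norm ((H ^^ k) z) ^ l \<le> c2 * (C * norm z) ^ l"
        using orbit[OF z(1), of k] c2 by (intro mult_left_mono power_mono) auto
      then show "\<phi> ((H ^^ k) z) \<le> c2 * (C * norm z) ^ l"
        using ang[of k] by simp
    qed
    then show "\<alpha> N z \<le> real N * (c2 * (C * norm z) ^ l)"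
      by simp
    have "(\<Sum>k<N. c1 * (norm z / C) ^ l) \<le> \<alpha> N z"
      unfolding \<alpha>_def
    proof (rule sum_mono)
      fix k
      have "norm z / C \<le> norm ((H ^^ k) z)"
        using orbit[OF z(1), of k] C by (simp add: field_simps)
      then have "c1 * (norm z / C) ^ l \<le> c1 * norm ((H ^^ k) z) ^ l"
        using C c by (intro mult_left_mono power_mono) auto
      then show "c1 * (norm z / C) ^ l \<le> \<phi> ((H ^^ k) z)"
        using ang[of k] by simp
    qed
    then show "real N * (c1 * (norm z / C) ^ l) \<le> \<alpha> N z"
      by simp
  qed
  have cont_orbit: "continuous_on (cball 0 \<delta> - {0}) (H ^^ k)" for k
  proof (induction k)
    case (Suc k)
    have "continuous_on (cball 0 \<delta> - {0}) (\<lambda>z. H ((H ^^ k) z))"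
      by (rule continuous_on_compose2[OF contH Suc]) (use orbit_r in auto)
    then show ?case
      by (simp add: o_def)
  qed (simp add: id_def)
  have cont\<alpha>: "continuous_on (cball 0 \<delta> - {0}) (\<alpha> N)" for N
    unfolding \<alpha>_def
    by (intro continuous_on_sum continuous_on_compose2[OF cont\<phi> cont_orbit])
       (use orbit_r orbit_0 in auto)
  have "0 < c1 * (\<delta> / C) ^ l"
    using c \<delta> C by simp
  \<comment> \<open>At radius \<open>\<delta>\<close> the lower bound exceeds a full turn for all
    directions at once, hence \<open>N\<close> does not depend on the ray.\<close>
  then obtain N where N: "2 * pi < real N * (c1 * (\<delta> / C) ^ l)"
    using reals_Archimedean3 by blast
  then have N0: "0 < N"
    by (cases N) auto
  \<comment> \<open>A point returns to its own ray when
    \<open>\<mu> ^ N * cis (\<epsilon> * \<alpha> N z) = 1\<close>. Conjugating for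
    \<open>\<epsilon> = - 1\<close> expresses both cases through a single angle
    \<open>t\<close>.\<close>
  have "norm (inverse (\<mu> ^ N)) = 1"
    using \<mu> by (simp add: norm_inverse norm_power)
  then have "norm (if \<epsilon> = 1 then inverse (\<mu> ^ N) else cnj (inverse (\<mu> ^ N))) = 1"
    by (simp del: complex_cnj_inverse complex_cnj_power)
  then obtain t0 where t0: "0 \<le> t0" "t0 < 2 * pi"
      "(if \<epsilon> = 1 then inverse (\<mu> ^ N) else cnj (inverse (\<mu> ^ N))) = cis t0"
    by (metis Arg2pi Arg2pi_eq Arg2pi_ge_0 Arg2pi_lt_2pi cis_conv_exp mult_1 of_real_1)
  \<comment> \<open>The accumulated angle tends to 0 towards the origin and passes a full turn at
    radius \<open>\<delta>\<close>, so the target must lie strictly above 0 and may equal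
    \<open>2 * pi\<close>; a representative 0 is replaced by the full turn.\<close>
  define t where "t = (if t0 = 0 then 2 * pi else t0)"
  have t: "0 < t" "t \<le> 2 * pi" "(if \<epsilon> = 1 then inverse (\<mu> ^ N) else cnj (inverse (\<mu> ^ N))) = cis t"
    using t0 by (auto simp: t_def)
  have t': "cis (\<epsilon> * t) = inverse (\<mu> ^ N)"
    using \<epsilon> t(3) by (auto simp: cis_cnj split: if_splits) (metis cis_cnj complex_cnj_cnj complex_cnj_inverse complex_cnj_power)
  have \<mu>N: "\<mu> ^ N \<noteq> 0"
    using \<mu> by auto
  have "\<exists>z. sgn z = u \<and> z \<in> {z. (H ^^ N) z = z \<and> (\<forall>k. (H ^^ k) z \<noteq> 0 \<and> norm ((H ^^ k) z) < r)}"
    if u: "norm u = 1" for u :: complex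
  proof -
    have u0: "u \<noteq> 0"
      using u by auto
    define g where "g s = \<alpha> N (complex_of_real s * u)" for s
    have nrm: "norm (complex_of_real s * u) = s" if "0 \<le> s" for s
      using u that by (simp add: norm_mult)
    have "((\<lambda>s. real N * (c2 * (C * s) ^ l)) \<longlongrightarrow> real N * (c2 * (C * 0) ^ l)) (at_right 0)"
      by (intro tendsto_intros)
    then have "((\<lambda>s. real N * (c2 * (C * s) ^ l)) \<longlongrightarrow> 0) (at_right 0)"
      using l by (simp add: zero_power)
    then have "eventually (\<lambda>s. real N * (c2 * (C * s) ^ l) < t) (at_right 0)"
      using t(1) by (rule order_tendstoD)
    moreover have "eventually (\<lambda>s. s \<in> {0<..<\<delta>}) (at_right 0)"
      using eventually_at_right_real[OF \<delta>(1)] .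
    ultimately have "eventually (\<lambda>s. real N * (c2 * (C * s) ^ l) < t \<and> s \<in> {0<..<\<delta>}) (at_right 0)"
      by (rule eventually_conj)
    then obtain s0 where s0: "real N * (c2 * (C * s0) ^ l) < t" "0 < s0" "s0 < \<delta>"
      using eventually_happens[of _ "at_right (0::real)"] by (auto simp: trivial_limit_at_right_real)
    have "g s0 \<le> t"
      using upper[of "complex_of_real s0 * u" N] s0 u u0 nrm[of s0] by (auto simp: g_def)
    moreover have "t \<le> g \<delta>"
      using lower[of "complex_of_real \<delta> * u" N] \<delta> u u0 nrm[of \<delta>] N t(2) by (auto simp: g_def)
    moreover have "continuous_on {s0..\<delta>} g"
      unfolding g_def
      by (rule continuous_on_compose2[OF cont\<alpha>]) (use s0 nrm u0 in \<open>auto intro!: continuous_intros\<close>)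
    ultimately obtain s where s: "s0 \<le> s" "s \<le> \<delta>" "g s = t"
      using IVT'[of g s0 t \<delta>] s0 by auto
    define z where "z = complex_of_real s * u"
    have z: "norm z = s" "norm z \<le> \<delta>" "z \<noteq> 0" and sz: "sgn z = u"
      using s s0 nrm[of s] u u0 by (auto simp: z_def sgn_mult sgn_of_real sgn_eq)
    define w where "w = (H ^^ N) z"
    have "sgn w = u"
      using arg[OF z(2,3), of N] s(3) t' \<mu>N sz by (simp add: w_def g_def z_def)
    then have w: "w = complex_of_real (norm w) * u"
      by (metis mult.commute sgn_eq nonzero_eq_divide_eq norm_eq_zero of_real_eq_0_iff norm_sgn u zero_neq_one)
    have "W w = W z" "0 < norm w" "norm w < r"
      using orbit[OF z(2), of N] orbit_0[OF z(2,3)] orbit_r[OF z(2)] by (auto simp: w_def)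
    then have "norm w = s"
      using ray[OF u, of s "norm w"] ray[OF u, of "norm w" s] w s s0 z r(2) orbit_r[OF z(2), of 0]
      by (metis (no_types, lifting) funpow_0 less_irrefl less_le_trans linorder_neqE_linordered_idom z_def)
    then have "(H ^^ N) z = z"
      using w by (simp add: w_def z_def)
    then show ?thesis
      using sz orbit_r[OF z(2)] orbit_0[OF z(2,3)] by (intro exI[of _ z]) auto
  qed
  then have "sphere 0 1 \<subseteq> sgn ` {z. (H ^^ N) z = z \<and> (\<forall>k. (H ^^ k) z \<noteq> 0 \<and> norm ((H ^^ k) z) < r)}"
    by force
  moreover have "infinite (sphere (0::complex) 1)"
  proof -
    have "inj_on cis {0..pi}"
      by (rule inj_onI) (auto simp: cis_conv_exp complex_eq_iff Re_exp Im_exp cos_inj_pi)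
    moreover have "infinite {0..pi}"
      using infinite_Icc pi_gt_zero by blast
    ultimately have "infinite (cis ` {0..pi})"
      using finite_image_iff by blast
    moreover have "cis ` {0..pi} \<subseteq> sphere 0 1"
      by auto
    ultimately show ?thesis
      using finite_subset by blast
  qed
  ultimately have "infinite {z. (H ^^ N) z = z \<and> (\<forall>k. (H ^^ k) z \<noteq> 0 \<and> norm ((H ^^ k) z) < r)}"
    by (meson finite_imageI finite_subset)
  with N0 that show thesis by blast
qed

text \<open>Writing \<open>H z = \<mu> * z * (1 + q z)\<close>, the angle gained beyond that of
  \<open>\<mu>\<close> is the imaginary part of \<open>Ln (1 + q z)\<close>. To leading order it
  equals \<open>b * norm z ^ (2 * n)\<close>, and the sign \<open>\<epsilon>\<close> of
  \<open>b\<close> makes it positive, which gives the two-sided bound asked of a twist.\<close>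

lemma infinite_periodic_points_of_normal_form:
  fixes H :: "complex \<Rightarrow> complex" and W :: "complex \<Rightarrow> real"
  assumes m: "0 < m" "m \<le> M" and r: "0 < r" "r \<le> R"
    and W: "\<And>z. norm z < R \<Longrightarrow> m * (norm z)\<^sup>2 \<le> W z \<and> W z \<le> M * (norm z)\<^sup>2"
    and H: "\<And>z. norm z < r \<Longrightarrow> norm (H z) < R \<and> W (H z) = W z"
    and ray: "\<And>u s t. norm u = 1 \<Longrightarrow> 0 < s \<Longrightarrow> s < t \<Longrightarrow> t < R \<Longrightarrow>
        W (complex_of_real s * u) < W (complex_of_real t * u)"
    and contH: "continuous_on (ball 0 r) H"
    and n: "0 < n" and b: "b \<noteq> 0" and \<mu>: "norm \<mu> = 1"
    and nf: "(\<lambda>z. H z - \<mu> * z * (1 + \<i> * complex_of_real b * complex_of_real (norm z ^ (2 * n))))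
        \<in> o[at 0](\<lambda>z. complex_of_real (norm z ^ (2 * n + 1)))"
  obtains N where "0 < N"
    "infinite {z. (H ^^ N) z = z \<and> (\<forall>k. (H ^^ k) z \<noteq> 0 \<and> norm ((H ^^ k) z) < r)}"
proof -
  have \<mu>0: "\<mu> \<noteq> 0"
    using \<mu> by auto
  define q where "q z = H z / (\<mu> * z) - 1" for z
  \<comment> \<open>With \<open>x = \<bar>b\<bar> * norm z ^ (2 * n)\<close>, the tolerance
    \<open>\<bar>b\<bar> / 4\<close> puts \<open>q z\<close> within \<open>x / 4\<close> of its
    leading term, and \<open>x < 1 / 16\<close> bounds the quadratic error of \<open>Ln\<close> by
    \<open>25 / 8 * x * x \<le> x / 5\<close>. Together they stay below \<open>x / 2\<close>, so the
    angle lies between \<open>x / 2\<close> and \<open>2 * x\<close>.\<close>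
  have "eventually (\<lambda>z. norm (H z - \<mu> * z * (1 + \<i> * complex_of_real b * complex_of_real (norm z ^ (2 * n))))
      \<le> \<bar>b\<bar> / 4 * norm (complex_of_real (norm z ^ (2 * n + 1)))) (at 0)"
    using landau_o.smallD[OF nf, of "\<bar>b\<bar> / 4"] b by simp
  moreover have "((\<lambda>z :: complex. \<bar>b\<bar> * norm z ^ (2 * n)) \<longlongrightarrow> \<bar>b\<bar> * norm (0 :: complex) ^ (2 * n)) (at 0)"
    by (intro tendsto_intros)
  then have "eventually (\<lambda>z :: complex. \<bar>b\<bar> * norm z ^ (2 * n) < 1 / 16) (at 0)"
    using n by (intro order_tendstoD) (auto simp: zero_power)
  ultimately have "eventually (\<lambda>z. norm (H z - \<mu> * z * (1 + \<i> * complex_of_real b * complex_of_real (norm z ^ (2 * n))))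
      \<le> \<bar>b\<bar> / 4 * norm (complex_of_real (norm z ^ (2 * n + 1))) \<and> \<bar>b\<bar> * norm z ^ (2 * n) < 1 / 16) (at 0)"
    by (rule eventually_conj)
  then obtain d where d: "0 < d" "\<And>z. z \<noteq> 0 \<Longrightarrow> norm z < d \<Longrightarrow>
      norm (H z - \<mu> * z * (1 + \<i> * complex_of_real b * complex_of_real (norm z ^ (2 * n))))
        \<le> \<bar>b\<bar> / 4 * norm (complex_of_real (norm z ^ (2 * n + 1))) \<and> \<bar>b\<bar> * norm z ^ (2 * n) < 1 / 16"
    by (auto simp: eventually_at dist_norm)
  define r' where "r' = min r d"
  have r': "0 < r'" "r' \<le> R" "r' \<le> r" "r' \<le> d"
    using r d(1) by (auto simp: r'_def)
  have q: "norm (q z - \<i> * complex_of_real (b * norm z ^ (2 * n))) \<le> \<bar>b\<bar> * norm z ^ (2 * n) / 4"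
      "\<bar>b\<bar> * norm z ^ (2 * n) < 1 / 16" if "z \<noteq> 0" "norm z < r'" for z
  proof -
    let ?e = "H z - \<mu> * z * (1 + \<i> * complex_of_real b * complex_of_real (norm z ^ (2 * n)))"
    have "q z - \<i> * complex_of_real (b * norm z ^ (2 * n)) = ?e / (\<mu> * z)"
      using that \<mu>0 by (simp add: q_def field_simps)
    then have "norm (q z - \<i> * complex_of_real (b * norm z ^ (2 * n))) = norm ?e / norm z"
      using \<mu> by (simp only: norm_divide norm_mult mult_1)
    also have "\<dots> \<le> (\<bar>b\<bar> / 4 * norm (complex_of_real (norm z ^ (2 * n + 1)))) / norm z"
      using d(2)[of z] that r' by (intro divide_right_mono) auto
    also have "\<dots> = \<bar>b\<bar> * norm z ^ (2 * n) / 4"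
      using that by (simp add: norm_power norm_mult)
    finally show "norm (q z - \<i> * complex_of_real (b * norm z ^ (2 * n))) \<le> \<bar>b\<bar> * norm z ^ (2 * n) / 4" .
    show "\<bar>b\<bar> * norm z ^ (2 * n) < 1 / 16"
      using d(2)[of z] that r' by auto
  qed
  have q1: "norm (q z) \<le> 5 / 4 * (\<bar>b\<bar> * norm z ^ (2 * n))" if "z \<noteq> 0" "norm z < r'" for z
  proof -
    have "norm (q z) \<le> norm (\<i> * complex_of_real (b * norm z ^ (2 * n)))
        + norm (q z - \<i> * complex_of_real (b * norm z ^ (2 * n)))"
      by (rule norm_triangle_sub)
    also have "norm (\<i> * complex_of_real (b * norm z ^ (2 * n))) = \<bar>b\<bar> * norm z ^ (2 * n)"
      by (simp add: norm_mult norm_power abs_mult)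
    finally show ?thesis
      using q(1)[OF that] by simp
  qed
  have q2: "norm (q z) < 1 / 2" if "z \<noteq> 0" "norm z < r'" for z
    using q1[OF that] q(2)[OF that] by simp
  define \<epsilon> where "\<epsilon> = sgn b"
  have \<epsilon>: "\<epsilon> = 1 \<or> \<epsilon> = - 1" "\<epsilon> * b = \<bar>b\<bar>"
    using b by (auto simp: \<epsilon>_def sgn_real_def)
  \<comment> \<open>The principal branch is safe: \<open>norm (q z) < 1 / 2\<close> keeps
    \<open>1 + q z\<close> in the right half-plane, where \<open>Ln\<close> is continuous.\<close>
  define \<phi> where "\<phi> z = \<epsilon> * Im (Ln (1 + q z))" for z
  have \<phi>: "\<bar>b\<bar> / 2 * norm z ^ (2 * n) \<le> \<phi> z \<and> \<phi> z \<le> 2 * \<bar>b\<bar> * norm z ^ (2 * n)"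
    if z: "z \<noteq> 0" "norm z < r'" for z
  proof -
    define x where "x = \<bar>b\<bar> * norm z ^ (2 * n)"
    have x: "0 \<le> x" "x < 1 / 16" "norm (q z) \<le> 5 / 4 * x"
      using q(2)[OF z] q1[OF z] by (auto simp: x_def)
    have "norm (Ln (1 + q z) - q z) \<le> (norm (q z))\<^sup>2 / (1 - norm (q z))"
      using q2[OF z] by (intro Ln_approx_linear) auto
    also have "\<dots> \<le> (5 / 4 * x)\<^sup>2 / (1 / 2)"
      using q2[OF z] x by (intro frac_le power_mono) auto
    also have "\<dots> = 25 / 8 * x * x"
      by (simp add: power2_eq_square)
    also have "\<dots> \<le> 25 / 8 * x * (1 / 16)"
      using x by (intro mult_left_mono) auto
    also have "\<dots> \<le> x / 5"
      using x by simp
    finally have 1: "\<bar>Im (Ln (1 + q z)) - Im (q z)\<bar> \<le> x / 5"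
      using abs_Im_le_cmod[of "Ln (1 + q z) - q z"] by simp
    have "\<bar>Im (q z) - b * norm z ^ (2 * n)\<bar> \<le> x / 4"
      using q(1)[OF z] abs_Im_le_cmod[of "q z - \<i> * complex_of_real (b * norm z ^ (2 * n))"]
      by (simp add: x_def)
    with 1 have "\<bar>Im (Ln (1 + q z)) - b * norm z ^ (2 * n)\<bar> \<le> x / 2"
      using x by linarith
    moreover have "\<bar>\<epsilon> * Im (Ln (1 + q z)) - \<epsilon> * (b * norm z ^ (2 * n))\<bar>
        = \<bar>Im (Ln (1 + q z)) - b * norm z ^ (2 * n)\<bar>"
      using \<epsilon>(1) by auto
    moreover have "\<epsilon> * (b * norm z ^ (2 * n)) = x"
      using \<epsilon>(2) by (simp add: x_def flip: mult.assoc)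
    ultimately have "\<bar>\<phi> z - x\<bar> \<le> x / 2"
      by (simp add: \<phi>_def)
    then have "x / 2 \<le> \<phi> z \<and> \<phi> z \<le> 2 * x"
      using x(1) by linarith
    then show ?thesis
      by (simp add: x_def mult_ac)
  qed
  have arg: "sgn (H z) = \<mu> * sgn z * cis (\<epsilon> * \<phi> z)" if z: "z \<noteq> 0" "norm z < r'" for z
  proof -
    have "1 + q z \<noteq> 0"
    proof
      assume "1 + q z = 0"
      then have "q z = - 1"
        by (simp add: add_eq_0_iff)
      with q2[OF z] show False
        by simp
    qed
    then have "H z = \<mu> * z * exp (Ln (1 + q z))"
      using z \<mu>0 by (simp add: q_def)
    also have "exp (Ln (1 + q z)) = complex_of_real (exp (Re (Ln (1 + q z)))) * cis (Im (Ln (1 + q z)))"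
      by (simp add: exp_eq_polar)
    finally have "sgn (H z) = sgn \<mu> * sgn z * sgn (cis (Im (Ln (1 + q z))))"
      by (simp add: sgn_mult sgn_of_real)
    moreover have "\<epsilon> * \<phi> z = Im (Ln (1 + q z))"
      using \<epsilon>(1) by (auto simp: \<phi>_def)
    moreover have "sgn \<mu> = \<mu>"
      using \<mu> by (simp add: sgn_eq)
    ultimately show ?thesis
      by (simp add: sgn_cis)
  qed
  have contq: "continuous_on (ball 0 r' - {0}) q"
    unfolding q_def using r' \<mu>0
    by (intro continuous_intros continuous_on_subset[OF contH]) auto
  have cont\<phi>: "continuous_on (ball 0 r' - {0}) \<phi>"
    unfolding \<phi>_def
  proof (intro continuous_intros contq)
    fix z :: complex assume "z \<in> ball 0 r' - {0}"
    then have "norm (q z) < 1 / 2"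
      using q2[of z] by simp
    then have "0 < Re (1 + q z)"
      using abs_Re_le_cmod[of "q z"] by simp
    then show "1 + q z \<notin> \<real>\<^sub>\<le>\<^sub>0"
      by (auto simp: complex_nonpos_Reals_iff)
  qed
  obtain N where "0 < N"
    "infinite {z. (H ^^ N) z = z \<and> (\<forall>k. (H ^^ k) z \<noteq> 0 \<and> norm ((H ^^ k) z) < r')}"
  proof (rule infinite_periodic_points_of_twist[where H = H and W = W and m = m and M = M and R = R
        and r = r' and \<phi> = \<phi> and l = "2 * n" and ?c1.0 = "\<bar>b\<bar> / 2" and ?c2.0 = "2 * \<bar>b\<bar>"
        and \<epsilon> = \<epsilon> and \<mu> = \<mu>])
    show "continuous_on (ball 0 r') H"
      by (rule continuous_on_subset[OF contH]) (use r' in auto)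
  qed (use m r' W H ray cont\<phi> n b \<phi> \<epsilon>(1) \<mu> arg in auto)
  moreover have "{z. (H ^^ N) z = z \<and> (\<forall>k. (H ^^ k) z \<noteq> 0 \<and> norm ((H ^^ k) z) < r')} \<subseteq>
      {z. (H ^^ N) z = z \<and> (\<forall>k. (H ^^ k) z \<noteq> 0 \<and> norm ((H ^^ k) z) < r)}"
    using r'(3) by (auto intro: less_le_trans)
  ultimately show thesis
    using that infinite_super by blast
qed

section \<open>Definiteness at a nondegenerate extremum and radial estimates\<close>

text \<open>The second difference \<open>\<Delta> h u v\<close> is symmetric in \<open>u\<close> and
  \<open>v\<close>, while its quotient by \<open>h\<^sup>2\<close> tends to
  \<open>L v \<bullet> u\<close>. Differentiability of the gradient at the single point
  \<open>p\<close> suffices for this limit.\<close>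

lemma gradient_derivative_symmetric:
  fixes V :: "'a::real_inner \<Rightarrow> real" and G :: "'a \<Rightarrow> 'a"
  assumes U: "open U" "p \<in> U"
    and V: "\<And>x. x \<in> U \<Longrightarrow> (V has_derivative (\<lambda>v. G x \<bullet> v)) (at x)"
    and G: "(G has_derivative L) (at p)"
  shows "L u \<bullet> v = L v \<bullet> u"
proof -
  interpret L: bounded_linear L
    using G by (rule has_derivative_bounded_linear)
  define \<Delta> where "\<Delta> h u v = V (p + h *\<^sub>R u + h *\<^sub>R v) - V (p + h *\<^sub>R u) - V (p + h *\<^sub>R v) + V p" for h u v
  have quotient: "\<exists>h0>0. \<forall>h. 0 < h \<longrightarrow> h < h0 \<longrightarrow> \<bar>\<Delta> h u v / h\<^sup>2 - L v \<bullet> u\<bar> \<le> e * ((2 * norm u + norm v) * norm u)"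
    if e: "0 < e" for e :: real and u v
  proof -
    obtain d1 where d1: "0 < d1" "\<And>y. norm (y - p) < d1 \<Longrightarrow> norm (G y - G p - L (y - p)) \<le> e * norm (y - p)"
      using G e unfolding has_derivative_at_alt by blast
    obtain d2 where d2: "0 < d2" "ball p d2 \<subseteq> U"
      using U openE by blast
    define d where "d = min d1 d2"
    define h0 where "h0 = d / (norm u + norm v + 1)"
    have den: "0 < norm u + norm v + 1"
      by (simp add: add_nonneg_pos)
    have h0: "0 < h0"
      using d1 d2 den by (simp add: h0_def d_def)
    have "\<bar>\<Delta> h u v / h\<^sup>2 - L v \<bullet> u\<bar> \<le> e * ((2 * norm u + norm v) * norm u)" if h: "0 < h" "h < h0" for h
    proof -
      have small: "norm (t *\<^sub>R u + s *\<^sub>R v) < d" if "0 \<le> t" "t \<le> h" "0 \<le> s" "s \<le> h" for t s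
      proof -
        have "norm (t *\<^sub>R u + s *\<^sub>R v) \<le> t * norm u + s * norm v"
          using that norm_triangle_ineq[of "t *\<^sub>R u" "s *\<^sub>R v"] by simp
        also have "\<dots> \<le> h * norm u + h * norm v"
          using that by (intro add_mono mult_right_mono) auto
        also have "\<dots> \<le> h * (norm u + norm v + 1)"
          using h by (simp add: algebra_simps)
        also have "\<dots> < d"
          using h den by (simp add: h0_def field_simps)
        finally show ?thesis .
      qed
      have inU: "p + t *\<^sub>R u + s *\<^sub>R v \<in> U" if "0 \<le> t" "t \<le> h" "0 \<le> s" "s \<le> h" for t s
      proof -
        have "dist p (p + w) = norm w" for w
          by (simp add: dist_norm)
        then have "p + t *\<^sub>R u + s *\<^sub>R v \<in> ball p d2"
          using small[OF that] by (simp add: d_def add.assoc)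
        then show ?thesis
          using d2 by blast
      qed
      have approx: "norm (G (p + t *\<^sub>R u + s *\<^sub>R v) - G p - L (t *\<^sub>R u + s *\<^sub>R v)) \<le> e * norm (t *\<^sub>R u + s *\<^sub>R v)"
        if "0 \<le> t" "t \<le> h" "0 \<le> s" "s \<le> h" for t s
        using d1(2)[of "p + t *\<^sub>R u + s *\<^sub>R v"] small[OF that] by (simp add: d_def add.assoc)
      \<comment> \<open>The mean value theorem along \<open>u\<close> leaves a difference of two
        gradients, both expanded about \<open>p\<close>. Their common part
        \<open>L (\<xi> *\<^sub>R u)\<close> cancels and \<open>h *\<^sub>R L v\<close> survives;
        \<open>\<xi> < h\<close> gives the factor \<open>2 * norm u + norm v\<close> for the two
        remainders.\<close>
      define g where "g t = V (p + t *\<^sub>R u + h *\<^sub>R v) - V (p + t *\<^sub>R u)" for t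
      have der: "(g has_real_derivative (G (p + t *\<^sub>R u + h *\<^sub>R v) - G (p + t *\<^sub>R u)) \<bullet> u) (at t)"
        if "0 \<le> t" "t \<le> h" for t
      proof -
        have "(g has_derivative (\<lambda>s. G (p + t *\<^sub>R u + h *\<^sub>R v) \<bullet> (s *\<^sub>R u) - G (p + t *\<^sub>R u) \<bullet> (s *\<^sub>R u))) (at t)"
          unfolding g_def
          by (intro has_derivative_diff has_derivative_compose[OF _ V])
             (use inU[of t h] inU[of t 0] that h in \<open>auto intro!: derivative_eq_intros\<close>)
        moreover have "(\<lambda>s. G (p + t *\<^sub>R u + h *\<^sub>R v) \<bullet> (s *\<^sub>R u) - G (p + t *\<^sub>R u) \<bullet> (s *\<^sub>R u))
            = (*) ((G (p + t *\<^sub>R u + h *\<^sub>R v) - G (p + t *\<^sub>R u)) \<bullet> u)"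
          by (auto simp: inner_diff_left algebra_simps)
        ultimately show ?thesis
          by (simp add: has_field_derivative_def)
      qed
      obtain \<xi> where \<xi>: "0 < \<xi>" "\<xi> < h"
        "g h - g 0 = (h - 0) * ((G (p + \<xi> *\<^sub>R u + h *\<^sub>R v) - G (p + \<xi> *\<^sub>R u)) \<bullet> u)"
        using MVT2[OF h(1), of g "\<lambda>t. (G (p + t *\<^sub>R u + h *\<^sub>R v) - G (p + t *\<^sub>R u)) \<bullet> u"] der by auto
      let ?r1 = "G (p + \<xi> *\<^sub>R u + h *\<^sub>R v) - G p - L (\<xi> *\<^sub>R u + h *\<^sub>R v)"
      let ?r2 = "G (p + \<xi> *\<^sub>R u) - G p - L (\<xi> *\<^sub>R u)"
      have "\<Delta> h u v = g h - g 0"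
        by (simp add: \<Delta>_def g_def)
      also have "\<dots> = h * (h * (L v \<bullet> u) + (?r1 - ?r2) \<bullet> u)"
        unfolding \<xi>(3) by (simp add: L.add L.scaleR inner_add_left inner_diff_left algebra_simps)
      finally have \<Delta>: "\<Delta> h u v = h * (h * (L v \<bullet> u) + (?r1 - ?r2) \<bullet> u)" .
      have "X / h\<^sup>2 - c = y / h" if "X = h * (h * c + y)" for X c y
        using h that by (simp add: field_simps power2_eq_square)
      from this[OF \<Delta>] have "\<Delta> h u v / h\<^sup>2 - L v \<bullet> u = ((?r1 - ?r2) \<bullet> u) / h" .
      moreover have "\<bar>(?r1 - ?r2) \<bullet> u\<bar> \<le> h * (e * ((2 * norm u + norm v) * norm u))"
      proof -
        have "norm (\<xi> *\<^sub>R u + h *\<^sub>R v) \<le> \<xi> * norm u + h * norm v"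
          using \<xi> h norm_triangle_ineq[of "\<xi> *\<^sub>R u" "h *\<^sub>R v"] by simp
        moreover have "\<xi> * norm u \<le> h * norm u"
          using \<xi> by (intro mult_right_mono) auto
        ultimately have "norm (\<xi> *\<^sub>R u + h *\<^sub>R v) + norm (\<xi> *\<^sub>R u) \<le> h * (2 * norm u + norm v)"
          using \<xi> by (simp add: algebra_simps)
        then have "e * norm (\<xi> *\<^sub>R u + h *\<^sub>R v) + e * norm (\<xi> *\<^sub>R u) \<le> e * (h * (2 * norm u + norm v))"
          unfolding distrib_left[symmetric] using e by (intro mult_left_mono) auto
        moreover have "norm (?r1 - ?r2) \<le> norm ?r1 + norm ?r2"
          by (rule norm_triangle_ineq4)
        ultimately have *: "norm (?r1 - ?r2) \<le> e * (h * (2 * norm u + norm v))"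
          using approx[of \<xi> h] approx[of \<xi> 0] \<xi> h by simp
        have "\<bar>(?r1 - ?r2) \<bullet> u\<bar> \<le> norm (?r1 - ?r2) * norm u"
          by (rule Cauchy_Schwarz_ineq2)
        also have "\<dots> \<le> e * (h * (2 * norm u + norm v)) * norm u"
          using * by (rule mult_right_mono) simp
        finally show ?thesis
          by (simp add: mult_ac)
      qed
      ultimately show ?thesis
        using h by (simp add: abs_divide pos_divide_le_eq mult_ac)
    qed
    with h0 show ?thesis by blast
  qed
  define K where "K = (2 * norm u + norm v) * norm u + (2 * norm v + norm u) * norm v"
  have le: "\<bar>L u \<bullet> v - L v \<bullet> u\<bar> \<le> e * K" if e: "0 < e" for e
  proof -
    obtain h1 where h1: "0 < h1"
      "\<And>h. 0 < h \<Longrightarrow> h < h1 \<Longrightarrow> \<bar>\<Delta> h u v / h\<^sup>2 - L v \<bullet> u\<bar> \<le> e * ((2 * norm u + norm v) * norm u)"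
      using quotient[OF e, of u v] by auto
    obtain h2 where h2: "0 < h2"
      "\<And>h. 0 < h \<Longrightarrow> h < h2 \<Longrightarrow> \<bar>\<Delta> h v u / h\<^sup>2 - L u \<bullet> v\<bar> \<le> e * ((2 * norm v + norm u) * norm v)"
      using quotient[OF e, of v u] by auto
    define h where "h = min h1 h2 / 2"
    have "\<Delta> h u v = \<Delta> h v u"
      by (simp add: \<Delta>_def add_ac)
    moreover have "0 < h" "h < h1" "h < h2"
      using h1(1) h2(1) by (auto simp: h_def)
    ultimately have "\<bar>\<Delta> h u v / h\<^sup>2 - L v \<bullet> u\<bar> \<le> e * ((2 * norm u + norm v) * norm u)"
        "\<bar>\<Delta> h u v / h\<^sup>2 - L u \<bullet> v\<bar> \<le> e * ((2 * norm v + norm u) * norm v)"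
      using h1(2)[of h] h2(2)[of h] by auto
    then show ?thesis
      unfolding K_def distrib_left[of e] by linarith
  qed
  have "0 \<le> K"
    by (simp add: K_def)
  have "\<bar>L u \<bullet> v - L v \<bullet> u\<bar> \<le> 0"
  proof (rule field_le_epsilon)
    fix e :: real assume e: "0 < e"
    have "\<bar>L u \<bullet> v - L v \<bullet> u\<bar> \<le> e / (K + 1) * K"
      using e \<open>0 \<le> K\<close> by (intro le) simp
    also have "\<dots> \<le> e / (K + 1) * (K + 1)"
      using e \<open>0 \<le> K\<close> by (intro mult_left_mono) auto
    also have "\<dots> = 0 + e"
      using \<open>0 \<le> K\<close> by simp
    finally show "\<bar>L u \<bullet> v - L v \<bullet> u\<bar> \<le> 0 + e" .
  qed
  then show ?thesis
    by simp
qed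

text \<open>The extremum only makes the form semidefinite. If a nonzero \<open>v\<close> had value
  0, a small move from \<open>v\<close> along \<open>L v\<close>, of the proper sign, would make the
  form negative, since by symmetry the first-order change is a nonzero multiple of
  \<open>L v \<bullet> L v\<close>.\<close>

lemma hessian_definite:
  fixes V :: "'a::real_inner \<Rightarrow> real" and G L :: "'a \<Rightarrow> 'a"
  assumes d: "0 < d"
    and V: "\<And>x. x \<in> ball p d \<Longrightarrow> (V has_derivative (\<lambda>v. G x \<bullet> v)) (at x)"
    and G: "(G has_derivative L) (at p)" and Gp: "G p = 0"
    and sym: "\<And>u v. L u \<bullet> v = L v \<bullet> u"
    and inj: "\<And>v. L v = 0 \<Longrightarrow> v = 0"
    and ext: "\<And>x. x \<in> ball p d \<Longrightarrow> s * V p \<le> s * V x"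
    and s: "s = 1 \<or> s = - 1" and v: "v \<noteq> 0"
  shows "0 < s * (L v \<bullet> v)"
proof -
  interpret L: bounded_linear L
    using G by (rule has_derivative_bounded_linear)
  have nonneg: "0 \<le> s * (L v \<bullet> v)" for v
  proof (rule ccontr)
    assume "\<not> 0 \<le> s * (L v \<bullet> v)"
    then have neg: "s * (L v \<bullet> v) < 0"
      by simp
    then have v: "v \<noteq> 0"
      by auto
    \<comment> \<open>With this \<open>e\<close> the remainder of the gradient can compensate at
      most half of the assumed negative curvature.\<close>
    define e where "e = - (s * (L v \<bullet> v)) / (2 * (norm v)\<^sup>2)"
    have e: "0 < e"
      using neg v by (simp add: e_def divide_pos_pos divide_less_0_iff)
    obtain d1 where d1: "0 < d1" "\<And>y. norm (y - p) < d1 \<Longrightarrow> norm (G y - G p - L (y - p)) \<le> e * norm (y - p)"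
      using G e unfolding has_derivative_at_alt by blast
    define h where "h = min d d1 / (2 * norm v)"
    have h: "0 < h" "h * norm v < d" "h * norm v < d1"
      using d d1 v by (auto simp: h_def)
    have in_ball: "p + t *\<^sub>R v \<in> ball p d" "norm (t *\<^sub>R v) < d1" if "0 \<le> t" "t \<le> h" for t
    proof -
      have "t * norm v \<le> h * norm v"
        using that by (intro mult_right_mono) auto
      moreover have "dist p (p + w) = norm w" for w
        by (simp add: dist_norm)
      ultimately show "p + t *\<^sub>R v \<in> ball p d" "norm (t *\<^sub>R v) < d1"
        using that h by auto
    qed
    have der: "((\<lambda>t. V (p + t *\<^sub>R v)) has_real_derivative G (p + t *\<^sub>R v) \<bullet> v) (at t)"
      if "0 \<le> t" "t \<le> h" for t
    proof -
      have "((\<lambda>t. V (p + t *\<^sub>R v)) has_derivative (\<lambda>s. G (p + t *\<^sub>R v) \<bullet> (s *\<^sub>R v))) (at t)"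
        by (rule has_derivative_compose[OF _ V])
           (use in_ball[OF that] in \<open>auto intro!: derivative_eq_intros\<close>)
      moreover have "(\<lambda>s. G (p + t *\<^sub>R v) \<bullet> (s *\<^sub>R v)) = (*) (G (p + t *\<^sub>R v) \<bullet> v)"
        by auto
      ultimately show ?thesis
        by (simp add: has_field_derivative_def)
    qed
    obtain \<xi> where \<xi>: "0 < \<xi>" "\<xi> < h" "V (p + h *\<^sub>R v) - V (p + 0 *\<^sub>R v) = (h - 0) * (G (p + \<xi> *\<^sub>R v) \<bullet> v)"
      using MVT2[OF h(1), of "\<lambda>t. V (p + t *\<^sub>R v)" "\<lambda>t. G (p + t *\<^sub>R v) \<bullet> v"] der by auto
    let ?r = "G (p + \<xi> *\<^sub>R v) - \<xi> *\<^sub>R L v"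
    have "norm ?r \<le> e * norm (\<xi> *\<^sub>R v)"
      using d1(2)[of "p + \<xi> *\<^sub>R v"] in_ball(2)[of \<xi>] \<xi> Gp by (simp add: L.scaleR)
    then have "\<bar>?r \<bullet> v\<bar> \<le> e * norm (\<xi> *\<^sub>R v) * norm v"
      using Cauchy_Schwarz_ineq2[of ?r v] mult_right_mono[of "norm ?r" _ "norm v"] by fastforce
    also have "\<dots> = \<xi> * (- (s * (L v \<bullet> v)) / 2)"
      using \<xi> v by (simp add: e_def power2_eq_square field_simps)
    finally have r: "\<bar>?r \<bullet> v\<bar> \<le> \<xi> * (- (s * (L v \<bullet> v)) / 2)" .
    have "s * (G (p + \<xi> *\<^sub>R v) \<bullet> v) = \<xi> * (s * (L v \<bullet> v)) + s * (?r \<bullet> v)"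
      by (simp add: inner_diff_left algebra_simps)
    also have "s * (?r \<bullet> v) \<le> \<bar>?r \<bullet> v\<bar>"
      using s by auto
    also note r
    also have "\<xi> * (s * (L v \<bullet> v)) + \<xi> * (- (s * (L v \<bullet> v)) / 2) = \<xi> * (s * (L v \<bullet> v) / 2)"
      by (simp add: field_simps)
    also have "\<dots> < 0"
      using \<xi> neg by (simp add: mult_pos_neg)
    finally have "h * (s * (G (p + \<xi> *\<^sub>R v) \<bullet> v)) < 0"
      using h by (simp add: mult_pos_neg)
    moreover have "s * V (p + h *\<^sub>R v) - s * V p = h * (s * (G (p + \<xi> *\<^sub>R v) \<bullet> v))"
      using \<xi>(3) s by auto
    ultimately show False
      using ext[of "p + h *\<^sub>R v"] in_ball[of h] h by simp
  qed
  have "s * (L v \<bullet> v) \<noteq> 0"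
  proof
    assume 0: "s * (L v \<bullet> v) = 0"
    define w where "w = L v"
    \<comment> \<open>The displacement \<open>s * t\<close> makes the linear coefficient the same
      for both signs, because \<open>s * s = 1\<close>.\<close>
    have quad: "0 \<le> 2 * t * (w \<bullet> w) + t\<^sup>2 * \<bar>L w \<bullet> w\<bar>" for t
    proof -
      have "0 \<le> s * (L (v + (s * t) *\<^sub>R w) \<bullet> (v + (s * t) *\<^sub>R w))"
        by (rule nonneg)
      also have "\<dots> = s * (L v \<bullet> v) + s * (s * t) * (L v \<bullet> w) + s * (s * t) * (L w \<bullet> v) + s * (s * t)\<^sup>2 * (L w \<bullet> w)"
        by (simp add: L.add L.scaleR inner_add_left inner_add_right algebra_simps power2_eq_square)
      also have "\<dots> = 2 * t * (w \<bullet> w) + s * t\<^sup>2 * (L w \<bullet> w)"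
        using 0 s sym[of w v] by (auto simp: w_def)
      also have "\<dots> \<le> 2 * t * (w \<bullet> w) + t\<^sup>2 * \<bar>L w \<bullet> w\<bar>"
        using s mult_left_mono[of "- (L w \<bullet> w)" "\<bar>L w \<bullet> w\<bar>" "t\<^sup>2"] mult_left_mono[of "L w \<bullet> w" "\<bar>L w \<bullet> w\<bar>" "t\<^sup>2"]
        by auto
      finally show ?thesis .
    qed
    have "w \<noteq> 0"
      using inj v by (auto simp: w_def)
    then have w: "0 < w \<bullet> w"
      by simp
    define c where "c = \<bar>L w \<bullet> w\<bar>"
    have c: "0 \<le> c"
      by (simp add: c_def)
    \<comment> \<open>Negative, and so small that \<open>t * c\<close> uses up at most half of the
      linear coefficient \<open>2 * (w \<bullet> w)\<close>.\<close>
    define t where "t = - (w \<bullet> w) / (c + 1)"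
    have t: "t < 0"
      using w c by (simp add: t_def divide_less_0_iff)
    have "t * c \<ge> - (w \<bullet> w)"
      using w c by (simp add: t_def field_simps)
    then have "0 < 2 * (w \<bullet> w) + t * c"
      using w by linarith
    then have "t * (2 * (w \<bullet> w) + t * c) < 0"
      using t by (simp add: mult_neg_pos)
    then show False
      using quad[of t] by (simp add: c_def power2_eq_square algebra_simps)
  qed
  with nonneg[of v] show ?thesis
    by linarith
qed

text \<open>The constants are the extreme values on the compact unit sphere; homogeneity carries
  them to all vectors.\<close>

lemma positive_form_bounds:
  fixes q :: "'a::euclidean_space \<Rightarrow> real"
  assumes cont: "continuous_on UNIV q" and hom: "\<And>t v. q (t *\<^sub>R v) = t\<^sup>2 * q v"
    and pos: "\<And>v. v \<noteq> 0 \<Longrightarrow> 0 < q v"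
  obtains c M where "0 < c" "c \<le> M" "\<And>v. c * (norm v)\<^sup>2 \<le> q v \<and> q v \<le> M * (norm v)\<^sup>2"
proof -
  have ne: "sphere (0::'a) 1 \<noteq> {}" and cs: "compact (sphere (0::'a) 1)"
    using nonempty_Basis norm_Basis by fastforce simp
  have cont': "continuous_on (sphere 0 1) q"
    by (rule continuous_on_subset[OF cont]) simp
  obtain a where a: "norm a = 1" "\<And>v. norm v = 1 \<Longrightarrow> q a \<le> q v"
    using continuous_attains_inf[OF cs ne cont'] by auto
  obtain b where b: "norm b = 1" "\<And>v. norm v = 1 \<Longrightarrow> q v \<le> q b"
    using continuous_attains_sup[OF cs ne cont'] by auto
  have "q a * (norm v)\<^sup>2 \<le> q v \<and> q v \<le> q b * (norm v)\<^sup>2" for v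
  proof (cases "v = 0")
    case False
    have eq: "q v = (norm v)\<^sup>2 * q (sgn v)"
      using hom[of "norm v" "sgn v"] False by (simp add: sgn_div_norm)
    show ?thesis
      unfolding eq using a(2)[of "sgn v"] b(2)[of "sgn v"] False by (simp add: norm_sgn mult.commute)
  next
    case True
    then show ?thesis
      using hom[of 0 v] by simp
  qed
  moreover have "0 < q a"
    using a(1) by (intro pos) auto
  ultimately show thesis
    using a b by (intro that[of "q a" "q b"]) auto
qed

text \<open>\<open>W' z z\<close> is the norm of \<open>z\<close> times the radial derivative of
  \<open>W\<close> at \<open>z\<close>. The hypothesis thus bounds that derivative between
  \<open>c * t\<close> and \<open>M * t\<close> at distance \<open>t\<close> from the origin;
  integration gives the quadratic bounds and positivity gives monotonicity on rays.\<close>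

lemma radial_derivative_bounds:
  fixes W :: "'a::real_normed_vector \<Rightarrow> real"
  assumes W0: "W 0 = 0" and c: "0 < c"
    and der: "\<And>z. norm z < R \<Longrightarrow> (W has_derivative W' z) (at z)"
    and bd: "\<And>z. norm z < R \<Longrightarrow> c * (norm z)\<^sup>2 \<le> W' z z \<and> W' z z \<le> M * (norm z)\<^sup>2"
  shows "norm z < R \<Longrightarrow> c / 2 * (norm z)\<^sup>2 \<le> W z \<and> W z \<le> M / 2 * (norm z)\<^sup>2"
    and "norm u = 1 \<Longrightarrow> 0 < s \<Longrightarrow> s < t \<Longrightarrow> t < R \<Longrightarrow> W (s *\<^sub>R u) < W (t *\<^sub>R u)"
proof -
  have rad: "((\<lambda>t. W (t *\<^sub>R u)) has_real_derivative W' (t *\<^sub>R u) u) (at t)" if "norm (t *\<^sub>R u) < R" for t u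
  proof -
    interpret W': bounded_linear "W' (t *\<^sub>R u)"
      using der[OF that] by (rule has_derivative_bounded_linear)
    have "((\<lambda>t. W (t *\<^sub>R u)) has_derivative (\<lambda>s. W' (t *\<^sub>R u) (s *\<^sub>R u))) (at t)"
      by (rule has_derivative_compose[where g = W and f = "\<lambda>t. t *\<^sub>R u"])
         (auto intro!: derivative_eq_intros der[OF that])
    moreover have "(\<lambda>s. W' (t *\<^sub>R u) (s *\<^sub>R u)) = (*) (W' (t *\<^sub>R u) u)"
      by (auto simp: W'.scaleR)
    ultimately show ?thesis
      by (simp add: has_field_derivative_def)
  qed
  have bd': "c * t * (norm u)\<^sup>2 \<le> W' (t *\<^sub>R u) u \<and> W' (t *\<^sub>R u) u \<le> M * t * (norm u)\<^sup>2"
    if "norm (t *\<^sub>R u) < R" "0 < t" for t u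
  proof -
    interpret W': bounded_linear "W' (t *\<^sub>R u)"
      using der[OF that(1)] by (rule has_derivative_bounded_linear)
    have "t * (c * t * (norm u)\<^sup>2) \<le> t * W' (t *\<^sub>R u) u \<and> t * W' (t *\<^sub>R u) u \<le> t * (M * t * (norm u)\<^sup>2)"
      using bd[OF that(1)] that(2) by (simp add: W'.scaleR power_mult_distrib power2_eq_square mult_ac)
    then show ?thesis
      using that(2) by simp
  qed
  show "c / 2 * (norm z)\<^sup>2 \<le> W z \<and> W z \<le> M / 2 * (norm z)\<^sup>2" if z: "norm z < R"
  proof -
    have in_R: "norm (t *\<^sub>R z) < R" if "0 \<le> t" "t \<le> 1" for t
      using mult_right_mono[OF that(2), of "norm z"] z that(1) by simp
    \<comment> \<open>Comparison with the quadratic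
      \<open>k / 2 * t\<^sup>2 * (norm z)\<^sup>2\<close>, used for \<open>k = c\<close> and
      \<open>k = M\<close>, replaces an integral by the mean value theorem.\<close>
    have d: "((\<lambda>t. W (t *\<^sub>R z) - k / 2 * t\<^sup>2 * (norm z)\<^sup>2) has_real_derivative
        W' (t *\<^sub>R z) z - k * t * (norm z)\<^sup>2) (at t)" if "0 \<le> t" "t \<le> 1" for t k
      by (rule derivative_eq_intros rad in_R that refl | simp)+
    obtain \<xi> where \<xi>: "0 < \<xi>" "\<xi> < 1" "W (1 *\<^sub>R z) - c / 2 * 1\<^sup>2 * (norm z)\<^sup>2 - (W (0 *\<^sub>R z) - c / 2 * 0\<^sup>2 * (norm z)\<^sup>2)
        = (1 - 0) * (W' (\<xi> *\<^sub>R z) z - c * \<xi> * (norm z)\<^sup>2)"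
      using MVT2[OF zero_less_one d[of _ c]] by metis
    obtain \<eta> where \<eta>: "0 < \<eta>" "\<eta> < 1" "W (1 *\<^sub>R z) - M / 2 * 1\<^sup>2 * (norm z)\<^sup>2 - (W (0 *\<^sub>R z) - M / 2 * 0\<^sup>2 * (norm z)\<^sup>2)
        = (1 - 0) * (W' (\<eta> *\<^sub>R z) z - M * \<eta> * (norm z)\<^sup>2)"
      using MVT2[OF zero_less_one d[of _ M]] by metis
    show ?thesis
      using \<xi>(3) \<eta>(3) bd'[OF in_R[of \<xi>]] bd'[OF in_R[of \<eta>]] \<xi>(1,2) \<eta>(1,2) W0 by simp
  qed
  show "W (s *\<^sub>R u) < W (t *\<^sub>R u)" if "norm u = 1" "0 < s" "s < t" "t < R"
  proof (rule DERIV_pos_imp_increasing[OF that(3)])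
    fix x assume x: "s \<le> x" "x \<le> t"
    then have *: "norm (x *\<^sub>R u) < R" "0 < x"
      using that by auto
    have "0 < c * x"
      using c * by simp
    then have "0 < W' (x *\<^sub>R u) u"
      using bd'[OF *] that(1) by auto
    then show "\<exists>y. ((\<lambda>x. W (x *\<^sub>R u)) has_real_derivative y) (at x) \<and> y > 0"
      using rad[OF *(1)] by blast
  qed
qed

text \<open>In finite dimension the values on a basis control the operator norm. This is needed
  because \<open>Ck_on\<close> speaks of derivatives in constant directions, whereas the radial
  derivative uses a direction that moves with the point.\<close>

lemma tendsto_linear_uniform:
  fixes E :: "'c \<Rightarrow> 'a::euclidean_space \<Rightarrow> 'b::real_normed_vector"
  assumes lin: "eventually (\<lambda>z. linear (E z)) F" "linear E0"
    and lim: "\<And>v. ((\<lambda>z. E z v) \<longlongrightarrow> E0 v) F" and e: "0 < e"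
  shows "eventually (\<lambda>z. \<forall>v. norm (E z v - E0 v) \<le> e * norm v) F"
proof -
  have "((\<lambda>z. \<Sum>b\<in>Basis. norm (E z b - E0 b)) \<longlongrightarrow> (\<Sum>b\<in>Basis. norm (E0 b - E0 b))) F"
    by (intro tendsto_intros lim)
  then have "eventually (\<lambda>z. (\<Sum>b\<in>Basis. norm (E z b - E0 b)) < e) F"
    using e by (intro order_tendstoD(2)) auto
  with lin(1) show ?thesis
  proof eventually_elim
    case (elim z)
    have lin_diff: "linear (\<lambda>v. E z v - E0 v)"
      using elim(1) lin(2) by (rule linear_compose_sub)
    show ?case
    proof
      fix v
      have "E z v - E0 v = (\<Sum>b\<in>Basis. (v \<bullet> b) *\<^sub>R (E z b - E0 b))"
        using linear_sum[OF lin_diff, of "\<lambda>b. (v \<bullet> b) *\<^sub>R b" Basis] linear_scale[OF lin_diff]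
        by (simp add: euclidean_representation)
      also have "norm \<dots> \<le> (\<Sum>b\<in>Basis. norm v * norm (E z b - E0 b))"
        by (rule sum_norm_le) (auto intro!: mult_right_mono Basis_le_norm)
      also have "\<dots> = norm v * (\<Sum>b\<in>Basis. norm (E z b - E0 b))"
        by (simp add: sum_distrib_left)
      also have "\<dots> \<le> norm v * e"
        using elim(2) by (intro mult_left_mono) auto
      finally show "norm (E z v - E0 v) \<le> e * norm v"
        by (simp add: mult.commute)
    qed
  qed
qed

text \<open>With \<open>G\<close> the gradient of \<open>V\<close>, the estimated quantity is the
  derivative of \<open>s * V (\<Psi> z)\<close> at \<open>z\<close> in direction \<open>z\<close>.
  No second derivative of the composition is taken: \<open>G (\<Psi> z)\<close> is expanded to first
  order at 0, \<open>E z\<close> is replaced by \<open>E 0\<close>, and the definite form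
  \<open>s * (L (E 0 z) \<bullet> E 0 z)\<close> dominates the error.\<close>

lemma pulled_back_gradient_bounds:
  fixes \<Psi> :: "'a::euclidean_space \<Rightarrow> 'b::euclidean_space" and G L :: "'b \<Rightarrow> 'b"
  assumes \<Psi>: "\<And>z. norm z < d \<Longrightarrow> (\<Psi> has_derivative E z) (at z)" "0 < d" "\<Psi> 0 = p"
    and G: "(G has_derivative L) (at p)" "G p = 0"
    and E: "\<And>v. ((\<lambda>z. E z v) \<longlongrightarrow> E 0 v) (at 0)"
    and s: "s = 1 \<or> s = - 1"
    and pos: "\<And>v. v \<noteq> 0 \<Longrightarrow> 0 < s * (L (E 0 v) \<bullet> E 0 v)"
  obtains c M R where "0 < c" "c \<le> M" "0 < R"
    "\<And>z. norm z < R \<Longrightarrow> c * (norm z)\<^sup>2 \<le> s * (G (\<Psi> z) \<bullet> E z z) \<and> s * (G (\<Psi> z) \<bullet> E z z) \<le> M * (norm z)\<^sup>2"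
proof -
  have \<Psi>0: "(\<Psi> has_derivative E 0) (at 0)"
    using \<Psi> by simp
  interpret E0: bounded_linear "E 0"
    using \<Psi>0 by (rule has_derivative_bounded_linear)
  interpret L: bounded_linear L
    using G(1) by (rule has_derivative_bounded_linear)
  have GE: "((\<lambda>z. G (\<Psi> z)) has_derivative (\<lambda>v. L (E 0 v))) (at 0)"
    using has_derivative_compose[OF \<Psi>0, of G L] G \<Psi>(3) by simp
  interpret A: bounded_linear "\<lambda>v. L (E 0 v)"
    using GE by (rule has_derivative_bounded_linear)
  define q where "q v = s * (L (E 0 v) \<bullet> E 0 v)" for v
  have "continuous_on UNIV q"
    unfolding q_def by (intro continuous_intros A.continuous_on E0.continuous_on)
  moreover have "q (t *\<^sub>R v) = t\<^sup>2 * q v" for t v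
    by (simp add: q_def E0.scaleR L.scaleR power2_eq_square)
  ultimately obtain c M where c: "0 < c" "c \<le> M" and q: "\<And>v. c * (norm v)\<^sup>2 \<le> q v \<and> q v \<le> M * (norm v)\<^sup>2"
    using positive_form_bounds[of q] pos unfolding q_def by blast
  obtain K1 where K1: "0 \<le> K1" "\<And>v. norm (L (E 0 v)) \<le> norm v * K1"
    using A.nonneg_bounded by blast
  obtain K2 where K2: "0 \<le> K2" "\<And>v. norm (E 0 v) \<le> norm v * K2"
    using E0.nonneg_bounded by blast
  \<comment> \<open>The errors add up to at most
    \<open>e * (K1 + K2 + 1) * (norm z)\<^sup>2\<close>, to be kept below half of the lower bound
    \<open>c\<close>; \<open>e \<le> 1\<close> makes the product of the two errors linear in
    \<open>e\<close>.\<close>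
  define e where "e = min 1 (c / (2 * (K1 + K2 + 1)))"
  have e: "0 < e" "e \<le> 1" "e * (K1 + K2 + 1) \<le> c / 2"
  proof -
    show "0 < e" "e \<le> 1"
      using c(1) K1(1) K2(1) by (simp_all add: e_def)
    have "e * (K1 + K2 + 1) \<le> c / (2 * (K1 + K2 + 1)) * (K1 + K2 + 1)"
      using K1(1) K2(1) by (intro mult_right_mono) (auto simp: e_def)
    also have "\<dots> = c / 2"
    proof -
      have "c / (2 * x) * x = c / 2" if "x \<noteq> 0" for x
        using that by simp
      moreover have "K1 + K2 + 1 \<noteq> 0"
        using K1(1) K2(1) by linarith
      ultimately show ?thesis
        by blast
    qed
    finally show "e * (K1 + K2 + 1) \<le> c / 2" .
  qed
  obtain d1 where d1: "0 < d1" "\<And>z. norm z < d1 \<Longrightarrow> norm (G (\<Psi> z) - L (E 0 z)) \<le> e * norm z"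
    using GE e(1) \<Psi>(3) G(2) unfolding has_derivative_at_alt by fastforce
  have "eventually (\<lambda>z. norm z < d) (at (0::'a))"
    using \<Psi>(2) by (auto simp: eventually_at dist_norm)
  then have "eventually (\<lambda>z. linear (E z)) (at 0)"
    by eventually_elim (use \<Psi>(1) in \<open>blast intro: has_derivative_linear\<close>)
  from tendsto_linear_uniform[OF this E0.linear_axioms E e(1)]
  obtain d2 where d2: "0 < d2" "\<And>z v. z \<noteq> 0 \<Longrightarrow> norm z < d2 \<Longrightarrow> norm (E z v - E 0 v) \<le> e * norm v"
    by (auto simp: eventually_at dist_norm)
  have est: "(c / 2) * (norm z)\<^sup>2 \<le> s * (G (\<Psi> z) \<bullet> E z z) \<and> s * (G (\<Psi> z) \<bullet> E z z) \<le> (M + c / 2) * (norm z)\<^sup>2"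
    if z: "norm z < min d1 d2" for z
  proof -
    define r1 where "r1 = G (\<Psi> z) - L (E 0 z)"
    define r2 where "r2 = E z z - E 0 z"
    have r1: "norm r1 \<le> e * norm z"
      using d1(2)[of z] z by (simp add: r1_def)
    have r2: "norm r2 \<le> e * norm z"
      using d2(2)[of z z] z e by (cases "z = 0") (auto simp: r2_def)
    have "\<bar>s * (G (\<Psi> z) \<bullet> E z z) - q z\<bar> = \<bar>G (\<Psi> z) \<bullet> E z z - L (E 0 z) \<bullet> E 0 z\<bar>"
      using s by (auto simp: q_def)
    also have "G (\<Psi> z) \<bullet> E z z - L (E 0 z) \<bullet> E 0 z = r1 \<bullet> E 0 z + L (E 0 z) \<bullet> r2 + r1 \<bullet> r2"
      by (simp add: r1_def r2_def inner_diff_left inner_diff_right)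
    also have "\<bar>\<dots>\<bar> \<le> norm r1 * norm (E 0 z) + norm (L (E 0 z)) * norm r2 + norm r1 * norm r2"
      using Cauchy_Schwarz_ineq2[of r1 "E 0 z"] Cauchy_Schwarz_ineq2[of "L (E 0 z)" r2]
        Cauchy_Schwarz_ineq2[of r1 r2] by linarith
    also have "\<dots> \<le> (e * norm z) * (norm z * K2) + (norm z * K1) * (e * norm z) + (1 * norm z) * (e * norm z)"
      using r1 r2 K1 K2 e order_trans[OF r1 mult_right_mono[OF e(2) norm_ge_zero]]
      by (intro add_mono mult_mono) auto
    also have "\<dots> = e * (K1 + K2 + 1) * (norm z)\<^sup>2"
      by (simp add: power2_eq_square algebra_simps)
    also have "\<dots> \<le> c / 2 * (norm z)\<^sup>2"
      using e(3) by (rule mult_right_mono) simp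
    finally have "\<bar>s * (G (\<Psi> z) \<bullet> E z z) - q z\<bar> \<le> c / 2 * (norm z)\<^sup>2" .
    moreover have "(c / 2) * k \<le> x \<and> x \<le> (M + c / 2) * k"
      if "\<bar>x - y\<bar> \<le> c / 2 * k" "c * k \<le> y \<and> y \<le> M * k" for x y k
    proof -
      have "c * k = c / 2 * k + c / 2 * k"
        by simp
      with that show ?thesis
        unfolding distrib_right by linarith
    qed
    ultimately show ?thesis
      using q[of z] by blast
  qed
  show thesis
    by (rule that[of "c / 2" "M + c / 2" "min d1 d2"]) (use c d1(1) d2(1) est in auto)
qed

section \<open>The first integral in normal form coordinates\<close>

lemma Ck_on_imp_continuous_on:
  "Ck_on k S f \<Longrightarrow> continuous_on S f"
  by (cases k) (auto intro!: differentiable_imp_continuous_on differentiable_at_imp_differentiable_on)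

lemma Ck_on_Suc_has_derivative:
  "Ck_on (Suc k) S f \<Longrightarrow> x \<in> S \<Longrightarrow> (f has_derivative frechet_derivative f (at x)) (at x)"
  by (simp flip: frechet_derivative_works)

lemma has_derivative_grad:
  assumes "V differentiable (at x)"
  shows "(V has_derivative (\<lambda>v. grad V x \<bullet> v)) (at x)"
proof -
  let ?D = "frechet_derivative V (at x)"
  have D: "(V has_derivative ?D) (at x)"
    using assms by (simp flip: frechet_derivative_works)
  then have lin: "linear ?D"
    by (rule has_derivative_linear)
  have "?D v = grad V x \<bullet> v" for v
  proof -
    have "?D v = ?D (\<Sum>i\<in>UNIV. (v $ i) *\<^sub>R axis i 1)"
      using basis_expansion[of v] by (simp add: scalar_mult_eq_scaleR)
    also have "\<dots> = (\<Sum>i\<in>UNIV. v $ i * ?D (axis i 1))"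
      by (simp add: linear_sum[OF lin] linear_scale[OF lin])
    also have "\<dots> = grad V x \<bullet> v"
      by (simp add: inner_vec_def grad_def mult.commute)
    finally show ?thesis .
  qed
  then have "?D = (\<lambda>v. grad V x \<bullet> v)"
    by auto
  with D show ?thesis
    by simp
qed

text \<open>The components of the gradient are directional derivatives in fixed directions, whose
  differentiability is what two levels of \<open>Ck_on\<close> provide.\<close>

lemma has_derivative_hessian:
  assumes "Ck_on (Suc (Suc k)) U V" "x \<in> U"
  shows "(grad V has_derivative (\<lambda>v. hessian V x *v v)) (at x)"
proof -
  have diff: "(\<lambda>x. frechet_derivative V (at x) v) differentiable (at x)" for v
    using assms by simp
  let ?D = "\<lambda>i. frechet_derivative (\<lambda>x. frechet_derivative V (at x) (axis i 1)) (at x)"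
  have "(grad V has_derivative (\<lambda>v. \<chi> i. ?D i v)) (at x)"
  proof (rule has_derivative_componentwise_within[THEN iffD2], rule ballI)
    fix e :: "real^2" assume "e \<in> Basis"
    then obtain i where e: "e = axis i 1"
      by (auto simp: Basis_vec_def)
    show "((\<lambda>x. grad V x \<bullet> e) has_derivative (\<lambda>v. (\<chi> i. ?D i v) \<bullet> e)) (at x)"
      using diff[of "axis i 1"]
      unfolding e inner_axis grad_def by (simp add: frechet_derivative_works)
  qed
  then have "grad V differentiable (at x)"
    by (auto simp: differentiable_def)
  then show ?thesis
    unfolding hessian_def jacobian_works .
qed

text \<open>A punctured ball is connected in dimension at least 2, so \<open>V\<close> cannot pass
  from below \<open>V p\<close> to above it without taking that value.\<close>

lemma punctured_ball_constant_sign: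
  fixes V :: "'a::euclidean_space \<Rightarrow> real"
  assumes "2 \<le> DIM('a)" and cont: "continuous_on (ball p d) V"
    and ne: "\<And>x. x \<in> ball p d \<Longrightarrow> x \<noteq> p \<Longrightarrow> V x \<noteq> V p"
  obtains s where "s = 1 \<or> s = (- 1 :: real)" "\<And>x. x \<in> ball p d \<Longrightarrow> s * V p \<le> s * V x"
proof -
  have con: "connected (V ` (ball p d - {p}))"
    by (rule connected_continuous_image[OF continuous_on_subset[OF cont]])
       (use connected_punctured_ball assms(1) in auto)
  have "(\<forall>x\<in>ball p d. V p \<le> V x) \<or> (\<forall>x\<in>ball p d. V x \<le> V p)"
  proof (rule ccontr)
    assume "\<not> ?thesis"
    then obtain x y where xy: "x \<in> ball p d" "y \<in> ball p d" "V x < V p" "V p < V y"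
      by (auto simp: not_le)
    then have "V x \<in> V ` (ball p d - {p})" "V y \<in> V ` (ball p d - {p})"
      by blast+
    with xy have "V p \<in> V ` (ball p d - {p})"
      using connectedD_interval[OF con, of "V x" "V y" "V p"] by auto
    then obtain z where "z \<in> ball p d - {p}" "V p = V z"
      by (rule imageE)
    with ne[of z] show False
      by simp
  qed
  then show thesis
  proof
    assume "\<forall>x\<in>ball p d. V p \<le> V x"
    then show thesis
      by (intro that[of 1]) auto
  next
    assume "\<forall>x\<in>ball p d. V x \<le> V p"
    then show thesis
      by (intro that[of "- 1"]) auto
  qed
qed

text \<open>A nondegenerate Hessian alone would allow a saddle; the hypothesis \<open>ne\<close>
  makes \<open>p\<close> an extremum and thereby the Hessian definite. The sign \<open>s\<close>
  treats maxima and minima alike.\<close>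

lemma nondegenerate_extremum_in_chart:
  fixes V :: "real^2 \<Rightarrow> real" and \<Psi> :: "'a::euclidean_space \<Rightarrow> real^2"
  assumes U: "open U" "p \<in> U" and V: "Ck_on (Suc (Suc k)) U V"
    and ne: "\<And>x. x \<in> U \<Longrightarrow> x \<noteq> p \<Longrightarrow> V x \<noteq> V p"
    and crit: "critical_point V p" and hess: "det (hessian V p) \<noteq> 0"
    and T: "open T" "0 \<in> T" and \<Psi>: "Ck_on (Suc j) T \<Psi>" "\<Psi> 0 = p"
    and \<Phi>: "\<And>z. z \<in> T \<Longrightarrow> \<Phi> (\<Psi> z) = z" "\<Phi> differentiable (at p)"
  obtains s m M R where "s = 1 \<or> s = - 1" "0 < m" "m \<le> M" "0 < R" "ball 0 R \<subseteq> T"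
    "\<And>z. norm z < R \<Longrightarrow> m * (norm z)\<^sup>2 \<le> s * (V (\<Psi> z) - V p) \<and> s * (V (\<Psi> z) - V p) \<le> M * (norm z)\<^sup>2"
    "\<And>u r t. norm u = 1 \<Longrightarrow> 0 < r \<Longrightarrow> r < t \<Longrightarrow> t < R \<Longrightarrow>
        s * (V (\<Psi> (r *\<^sub>R u)) - V p) < s * (V (\<Psi> (t *\<^sub>R u)) - V p)"
proof -
  define L where "L v = hessian V p *v v" for v
  define E where "E z = frechet_derivative \<Psi> (at z)" for z
  have dV: "(V has_derivative (\<lambda>v. grad V x \<bullet> v)) (at x)" if "x \<in> U" for x
    using V that by (intro has_derivative_grad) simp
  have dG: "(grad V has_derivative L) (at p)"
    unfolding L_def using V U(2) by (rule has_derivative_hessian)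
  have sym: "L u \<bullet> v = L v \<bullet> u" for u v
    using gradient_derivative_symmetric[OF U dV dG] .
  have inj: "v = 0" if "L v = 0" for v
    using that hess by (metis L_def invertible_det_nz invertible_left_inverse matrix_left_invertible_ker)
  have "(\<lambda>v. grad V p \<bullet> v) = (\<lambda>v. 0)"
    using has_derivative_unique[OF dV[OF U(2)]] crit by (simp add: critical_point_def)
  then have G0: "grad V p = 0"
    by (metis inner_eq_zero_iff)
  obtain d where d: "0 < d" "ball p d \<subseteq> U"
    using U openE by blast
  have "continuous_on (ball p d) V"
    using Ck_on_imp_continuous_on[OF V] d(2) continuous_on_subset by blast
  then obtain s where s: "s = 1 \<or> s = (- 1 :: real)" "\<And>x. x \<in> ball p d \<Longrightarrow> s * V p \<le> s * V x"
    by (rule punctured_ball_constant_sign[rotated]) (use ne d(2) in auto)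
  have def: "0 < s * (L v \<bullet> v)" if "v \<noteq> 0" for v
    by (rule hessian_definite[where V = V and G = "grad V" and d = d and p = p])
       (use d dV dG G0 sym inj s that in blast)+
  have d\<Psi>: "(\<Psi> has_derivative E z) (at z)" if "z \<in> T" for z
    unfolding E_def using \<Psi>(1) that by (rule Ck_on_Suc_has_derivative)
  obtain \<Phi>' where \<Phi>': "(\<Phi> has_derivative \<Phi>') (at p)"
    using \<Phi>(2) by (auto simp: differentiable_def)
  \<comment> \<open>Differentiating the identity \<open>\<Phi> (\<Psi> z) = z\<close> at 0 shows
    that \<open>E 0\<close> is injective, so the pulled back form is still definite.\<close>
  have "((\<lambda>z. \<Phi> (\<Psi> z)) has_derivative (\<lambda>v. \<Phi>' (E 0 v))) (at 0)"
    using has_derivative_compose[OF d\<Psi>[OF T(2)], of \<Phi> \<Phi>'] \<Phi>' \<Psi>(2) by simp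
  moreover have "((\<lambda>z. \<Phi> (\<Psi> z)) has_derivative (\<lambda>v. v)) (at 0)"
    by (rule has_derivative_transform_within_open[OF has_derivative_ident T]) (simp add: \<Phi>(1))
  ultimately have "(\<lambda>v. \<Phi>' (E 0 v)) = (\<lambda>v. v)"
    by (rule has_derivative_unique)
  moreover have "\<Phi>' 0 = 0"
    using has_derivative_linear[OF \<Phi>'] by (rule linear_0)
  ultimately have E0: "E 0 v \<noteq> 0" if "v \<noteq> 0" for v
    using that by metis
  have contE: "((\<lambda>z. E z v) \<longlongrightarrow> E 0 v) (at 0)" for v
  proof -
    have "continuous_on T (\<lambda>z. E z v)"
      using \<Psi>(1) by (auto simp: E_def intro: Ck_on_imp_continuous_on)
    then have "isCont (\<lambda>z. E z v) 0"
      using T continuous_on_eq_continuous_at by blast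
    then show ?thesis
      by (simp add: isCont_def)
  qed
  have "continuous_on T \<Psi>"
    using \<Psi>(1) by (rule Ck_on_imp_continuous_on)
  then have "open (T \<inter> \<Psi> -` U)"
    using T(1) U(1) by (rule continuous_open_preimage)
  moreover have "0 \<in> T \<inter> \<Psi> -` U"
    using T(2) U(2) \<Psi>(2) by simp
  ultimately obtain d' where d': "0 < d'" "ball 0 d' \<subseteq> T \<inter> \<Psi> -` U"
    using openE by blast
  obtain c M R where c: "0 < c" "c \<le> M" "0 < R" and
    bd: "\<And>z. norm z < R \<Longrightarrow> c * (norm z)\<^sup>2 \<le> s * (grad V (\<Psi> z) \<bullet> E z z) \<and> s * (grad V (\<Psi> z) \<bullet> E z z) \<le> M * (norm z)\<^sup>2"
  proof (rule pulled_back_gradient_bounds[where \<Psi> = \<Psi> and d = d' and E = E and G = "grad V" and L = L and p = p and s = s])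
    show "(\<Psi> has_derivative E z) (at z)" if "norm z < d'" for z
      using d\<Psi>[of z] d'(2) that by auto
    show "0 < s * (L (E 0 v) \<bullet> E 0 v)" if "v \<noteq> 0" for v
      using def E0 that by simp
  qed (use d'(1) \<Psi>(2) dG G0 contE s(1) in blast)+
  define R' where "R' = min R d'"
  define W where "W z = s * (V (\<Psi> z) - V p)" for z
  have dW: "(W has_derivative (\<lambda>v. s * (grad V (\<Psi> z) \<bullet> E z v))) (at z)" if "norm z < R'" for z
  proof -
    have z: "z \<in> T" "\<Psi> z \<in> U"
      using that d'(2) by (auto simp: R'_def)
    have "((\<lambda>z. V (\<Psi> z)) has_derivative (\<lambda>v. grad V (\<Psi> z) \<bullet> E z v)) (at z)"
      using has_derivative_compose[OF d\<Psi>[OF z(1)] dV[OF z(2)]] .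
    from has_derivative_mult_right[OF has_derivative_diff[OF this has_derivative_const[of "V p"]], of s]
    show ?thesis
      by (simp add: W_def[abs_def])
  qed
  have bd': "c * (norm z)\<^sup>2 \<le> s * (grad V (\<Psi> z) \<bullet> E z z) \<and> s * (grad V (\<Psi> z) \<bullet> E z z) \<le> M * (norm z)\<^sup>2"
    if "norm z < R'" for z
    using bd that by (simp add: R'_def)
  have W0: "W 0 = 0"
    by (simp add: W_def \<Psi>(2))
  show thesis
  proof (rule that[of s "c / 2" "M / 2" R'])
    show "c / 2 * (norm z)\<^sup>2 \<le> s * (V (\<Psi> z) - V p) \<and> s * (V (\<Psi> z) - V p) \<le> M / 2 * (norm z)\<^sup>2"
      if "norm z < R'" for z
      using radial_derivative_bounds(1)[where W = W, OF W0 c(1) dW bd' that] by (simp add: W_def)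
    show "s * (V (\<Psi> (r *\<^sub>R u)) - V p) < s * (V (\<Psi> (t *\<^sub>R u)) - V p)"
      if "norm u = 1" "0 < r" "r < t" "t < R'" for u r t
      using radial_derivative_bounds(2)[where W = W, OF W0 c(1) dW bd' that] by (simp add: W_def)
    show "ball 0 R' \<subseteq> T"
      using d'(2) by (auto simp: R'_def)
  qed (use s(1) c d'(1) in \<open>auto simp: R'_def\<close>)
qed

section \<open>Application to the planar map\<close>

text \<open>For \<open>k = 2 * n + 1\<close> the sum ends at \<open>(k - 1) div 2 = n\<close>, so
  its last term is the only one left.\<close>

lemma birkhoff_poly_first_nonzero:
  assumes "0 < n" "\<forall>j. 0 < j \<and> j < n \<longrightarrow> B j = 0"
  shows "birkhoff_poly \<mu> (2 * n + 1) B z = \<mu> * z * (1 + B n * complex_of_real (norm z ^ (2 * n)))"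
proof -
  have "(\<Sum>j = 1..n. B j * (z * cnj z) ^ j) = (\<Sum>j \<in> {n}. B j * (z * cnj z) ^ j)"
    by (rule sum.mono_neutral_right) (use assms in auto)
  then show ?thesis
    by (simp add: birkhoff_poly_def complex_norm_square[symmetric] power_mult flip: of_real_power)
qed

lemma isCont_eventually_nhds:
  "isCont f x \<Longrightarrow> open A \<Longrightarrow> f x \<in> A \<Longrightarrow> eventually (\<lambda>z. f z \<in> A) (nhds x)"
  by (simp add: isCont_def tendsto_at_iff_tendsto_nhds topological_tendstoD)

lemma isCont_recurrence_map:
  assumes "p \<in> recurrence_dom P Q"
  shows "isCont (recurrence_map P Q) p"
proof -
  have "((\<lambda>v. recurrence_map P Q v $ i) \<longlongrightarrow> recurrence_map P Q p $ i) (at p)" for i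
  proof (cases "i = 1")
    case True
    have "((\<lambda>v. v $ 2) \<longlongrightarrow> p $ 2) (at p)"
      by (intro tendsto_intros)
    then show ?thesis
      by (simp add: True recurrence_map_def)
  next
    case False
    then have "i = 2"
      using exhaust_2 by blast
    moreover have "((\<lambda>v. poly P (v $ 2) / poly Q (v $ 2) / v $ 1) \<longlongrightarrow> poly P (p $ 2) / poly Q (p $ 2) / p $ 1) (at p)"
      using assms by (intro tendsto_intros) (auto simp: recurrence_dom_def)
    ultimately show ?thesis
      by (simp add: recurrence_map_def)
  qed
  then show ?thesis
    unfolding isCont_def by (rule vec_tendstoI)
qed

lemma open_recurrence_dom: "open (recurrence_dom P Q)"
proof -
  have "open {v :: real^2. v $ 1 \<noteq> 0}" "open {v :: real^2. poly Q (v $ 2) \<noteq> 0}"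
    by (intro open_Collect_neq continuous_intros)+
  then have "open ({v :: real^2. v $ 1 \<noteq> 0} \<inter> {v. poly Q (v $ 2) \<noteq> 0})"
    by (rule open_Int)
  then show ?thesis
    by (simp add: recurrence_dom_def Collect_conj_eq)
qed

theorem theorem6:
  fixes P Q :: "real poly" and p :: "real^2" and \<mu> :: complex
    and n :: nat and B :: "nat \<Rightarrow> complex" and b :: real
  assumes "Q \<noteq> 0" and "rat_degree P Q > 2"
    and "elliptic_fixed_point (recurrence_dom P Q) (recurrence_map P Q) p \<mu>"
    and "0 < n" and "\<not> resonant (2 * n + 1) \<mu>"
    and "birkhoff_constants (recurrence_map P Q) p \<mu> (2 * n + 1) B"
    and "\<forall>j. 0 < j \<and> j < n \<longrightarrow> B j = 0" and "B n = \<i> * complex_of_real b" and "b \<noteq> 0"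
  shows "\<not> locally_integrable_at (2 * n + 4) (recurrence_dom P Q) (recurrence_map P Q) p"
proof
  define F where "F = recurrence_map P Q"
  define D where "D = recurrence_dom P Q"
  assume "locally_integrable_at (2 * n + 4) (recurrence_dom P Q) (recurrence_map P Q) p"
  then have "locally_integrable_at (2 * n + 4) D F p"
    by (simp only: F_def D_def)
  then obtain U V where U: "open U" "p \<in> U" and V: "Ck_on (2 * n + 4) U V"
    and inv': "\<forall>x \<in> U \<inter> D. F x \<in> U \<longrightarrow> V (F x) = V x"
    and curves: "\<forall>h \<in> V ` (U - {p}). closed_curve_surrounding p {x \<in> U. V x = h}"
    and isol: "p isolated_in {x \<in> U. critical_point V x}" and hess: "det (hessian V p) \<noteq> 0"
    unfolding locally_integrable_at_def by (elim exE conjE) (rule that)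
  have inv: "V (F x) = V x" if "x \<in> U \<inter> D" "F x \<in> U" for x
    using inv' that by blast
  have crit: "critical_point V p"
    using isol by (simp add: isolated_in_def)
  have "birkhoff_constants F p \<mu> (2 * n + 1) B"
    using assms(6) by (simp only: F_def)
  then obtain S T \<Phi> \<Psi> where diffeo: "Ck_diffeo (2 * n + 1) S T \<Phi> \<Psi>" and S: "p \<in> S" "\<Phi> p = 0"
    and nf: "(\<lambda>z. \<Phi> (F (\<Psi> z)) - birkhoff_poly \<mu> (2 * n + 1) B z)
        \<in> o[at 0](\<lambda>z. complex_of_real (cmod z ^ (2 * n + 1)))"
    unfolding birkhoff_constants_def by (elim exE conjE) (rule that)
  have open_ST: "open S" "open T" and \<Phi>: "Ck_on (2 * n + 1) S \<Phi>" and \<Psi>: "Ck_on (2 * n + 1) T \<Psi>"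
    and inv_S: "\<And>x. x \<in> S \<Longrightarrow> \<Psi> (\<Phi> x) = x \<and> \<Phi> x \<in> T" and inv_T: "\<And>z. z \<in> T \<Longrightarrow> \<Phi> (\<Psi> z) = z \<and> \<Psi> z \<in> S"
    using diffeo by (auto simp: Ck_diffeo_def homeomorphism_def)
  have T0: "0 \<in> T" "\<Psi> 0 = p"
    using inv_S[OF S(1)] S(2) by auto
  have pD: "p \<in> D" "F p = p" and \<mu>: "cmod \<mu> = 1"
    using assms(3) by (auto simp: elliptic_fixed_point_def D_def F_def)
  \<comment> \<open>A second point at the level of \<open>p\<close> would make that level a closed
    curve having \<open>p\<close> both on it and inside it.\<close>
  have ne: "V x \<noteq> V p" if "x \<in> U" "x \<noteq> p" for x
  proof
    assume "V x = V p"
    moreover have "closed_curve_surrounding p {y \<in> U. V y = V x}"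
      using curves that by blast
    ultimately have "p \<in> inside {y \<in> U. V y = V x}" "p \<in> {y \<in> U. V y = V x}"
      using U(2) by (auto simp: closed_curve_surrounding_def)
    then show False
      using inside_no_overlap by blast
  qed
  have V2: "Ck_on (Suc (Suc (2 * n + 2))) U V"
    using V by (simp add: numeral_eq_Suc)
  have \<Psi>1: "Ck_on (Suc (2 * n)) T \<Psi>"
    using \<Psi> by simp
  have \<Phi>_diff: "\<Phi> differentiable (at p)"
    using \<Phi> S(1) by simp
  obtain s m M R where s: "s = 1 \<or> s = - 1" and m: "0 < m" "m \<le> M" and R: "0 < R" "ball 0 R \<subseteq> T"
    and W: "\<And>z. norm z < R \<Longrightarrow> m * (norm z)\<^sup>2 \<le> s * (V (\<Psi> z) - V p) \<and> s * (V (\<Psi> z) - V p) \<le> M * (norm z)\<^sup>2"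
    and ray: "\<And>u r t. norm u = 1 \<Longrightarrow> 0 < r \<Longrightarrow> r < t \<Longrightarrow> t < R \<Longrightarrow>
        s * (V (\<Psi> (r *\<^sub>R u)) - V p) < s * (V (\<Psi> (t *\<^sub>R u)) - V p)"
    by (rule nondegenerate_extremum_in_chart[OF U V2 ne crit hess open_ST(2) T0(1) \<Psi>1 T0(2) _ \<Phi>_diff])
       (use inv_T in auto)
  define H where "H z = \<Phi> (F (\<Psi> z))" for z
  have cont\<Psi>: "isCont \<Psi> z" if "z \<in> T" for z
    using Ck_on_imp_continuous_on[OF \<Psi>] open_ST(2) that continuous_on_eq_continuous_at by blast
  have cont\<Phi>: "isCont \<Phi> x" if "x \<in> S" for x
    using Ck_on_imp_continuous_on[OF \<Phi>] open_ST(1) that continuous_on_eq_continuous_at by blast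
  have contF: "isCont F x" if "x \<in> D" for x
    using that isCont_recurrence_map by (simp add: F_def D_def)
  have contF\<Psi>: "isCont (\<lambda>z. F (\<Psi> z)) z" if "z \<in> T" "\<Psi> z \<in> D" for z
    using isCont_o2[OF cont\<Psi>[OF that(1)] contF[OF that(2)]] .
  have contH: "isCont H z" if "z \<in> T" "\<Psi> z \<in> D" "F (\<Psi> z) \<in> S" for z
    unfolding H_def using isCont_o2[OF contF\<Psi>[OF that(1,2)] cont\<Phi>[OF that(3)]] .
  have H0: "H 0 = 0"
    using T0 pD S by (simp add: H_def)
  \<comment> \<open>The radius is shrunk until one application of the map stays in the domain, in
    the chart and in the region of invariance. The filter \<open>nhds 0\<close> includes the origin
    itself.\<close>
  have "eventually (\<lambda>z. \<Psi> z \<in> D \<inter> U) (nhds 0)"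
    by (rule isCont_eventually_nhds)
       (use cont\<Psi>[OF T0(1)] open_recurrence_dom[of P Q] U pD(1) T0(2) in \<open>auto simp: D_def\<close>)
  moreover have "eventually (\<lambda>z. F (\<Psi> z) \<in> S \<inter> U) (nhds 0)"
    by (rule isCont_eventually_nhds) (use contF\<Psi>[of 0] open_ST(1) U S(1) pD T0 in auto)
  moreover have "eventually (\<lambda>z. H z \<in> ball 0 R) (nhds 0)"
    by (rule isCont_eventually_nhds) (use contH[of 0] S(1) pD T0 H0 R(1) in auto)
  ultimately have "eventually (\<lambda>z. \<Psi> z \<in> D \<inter> U \<and> F (\<Psi> z) \<in> S \<inter> U \<and> H z \<in> ball 0 R) (nhds 0)"
    by eventually_elim auto
  then obtain d where d: "0 < d" "\<And>z. norm z < d \<Longrightarrow> \<Psi> z \<in> D \<inter> U \<and> F (\<Psi> z) \<in> S \<inter> U \<and> H z \<in> ball 0 R"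
    by (auto simp: eventually_nhds_metric dist_norm)
  define r where "r = min d R"
  have r: "0 < r" "r \<le> R"
    using d R by (auto simp: r_def)
  have near: "z \<in> T" "\<Psi> z \<in> D" "\<Psi> z \<in> U" "F (\<Psi> z) \<in> S" "F (\<Psi> z) \<in> U" "norm (H z) < R" "\<Psi> (H z) = F (\<Psi> z)"
    if "norm z < r" for z
    using that d(2)[of z] R(2) inv_S by (auto simp: r_def H_def)
  obtain N where N: "0 < N"
    and inf: "infinite {z. (H ^^ N) z = z \<and> (\<forall>k. (H ^^ k) z \<noteq> 0 \<and> norm ((H ^^ k) z) < r)}"
  proof (rule infinite_periodic_points_of_normal_form[where H = H and W = "\<lambda>z. s * (V (\<Psi> z) - V p)"
        and m = m and M = M and R = R and r = r and n = n and b = b and \<mu> = \<mu>])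
    show "norm (H z) < R \<and> s * (V (\<Psi> (H z)) - V p) = s * (V (\<Psi> z) - V p)" if "norm z < r" for z
      using near[OF that] inv[of "\<Psi> z"] by simp
    show "s * (V (\<Psi> (complex_of_real t * u)) - V p) < s * (V (\<Psi> (complex_of_real t' * u)) - V p)"
      if "norm u = 1" "0 < t" "t < t'" "t' < R" for u t t'
      using ray[OF that] by (simp add: scaleR_conv_of_real)
    show "continuous_on (ball 0 r) H"
      using contH near by (intro continuous_at_imp_continuous_on) auto
    show "(\<lambda>z. H z - \<mu> * z * (1 + \<i> * complex_of_real b * complex_of_real (norm z ^ (2 * n))))
        \<in> o[at 0](\<lambda>z. complex_of_real (norm z ^ (2 * n + 1)))"
      using nf unfolding birkhoff_poly_first_nonzero[OF assms(4,7)] assms(8) H_def .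
  qed (use m r W assms(4,9) \<mu> in auto)
  define Z where "Z = {z. (H ^^ N) z = z \<and> (\<forall>k. (H ^^ k) z \<noteq> 0 \<and> norm ((H ^^ k) z) < r)}"
  \<comment> \<open>The conjugacy holds only within radius \<open>r\<close>, so it can be iterated
    only because \<open>Z\<close> demands that whole orbits stay there.\<close>
  have iter: "(F ^^ k) (\<Psi> z) = \<Psi> ((H ^^ k) z)" if "z \<in> Z" for z k
    by (induction k) (use that near(7) in \<open>auto simp: Z_def\<close>)
  have "\<Psi> ` Z \<subseteq> {v. (F ^^ N) v = v \<and> (\<forall>k. (F ^^ k) v \<in> D)}"
  proof
    fix v assume "v \<in> \<Psi> ` Z"
    then obtain z where z: "z \<in> Z" "v = \<Psi> z"
      by auto
    then show "v \<in> {v. (F ^^ N) v = v \<and> (\<forall>k. (F ^^ k) v \<in> D)}"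
      using iter[OF z(1)] near(2) by (auto simp: Z_def)
  qed
  moreover have "finite {v. (F ^^ N) v = v \<and> (\<forall>k. (F ^^ k) v \<in> D)}"
    unfolding F_def D_def
    by (rule finite_periodic_points[OF _ N]) (use assms(2) in \<open>simp add: rat_degree_def\<close>)
  ultimately have "finite (\<Psi> ` Z)"
    by (rule finite_subset)
  \<comment> \<open>The orbit condition at \<open>k = 0\<close> places \<open>z\<close> itself in
    the chart, where \<open>\<Phi>\<close> undoes \<open>\<Psi>\<close>; hence no periodic points
    are lost in passing to the plane.\<close>
  moreover have "inj_on \<Psi> Z"
  proof (rule inj_on_inverseI)
    fix z assume "z \<in> Z"
    then have "norm ((H ^^ 0) z) < r"
      unfolding Z_def by blast
    then show "\<Phi> (\<Psi> z) = z"
      using near(1) inv_T by simp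
  qed
  ultimately have "finite Z"
    using finite_imageD by blast
  with inf show False
    by (simp add: Z_def)
qed

end
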